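(* Let $W$ be an $r \times c$ storage area with $c \ge 3$ whose open side is its bottom (front) row. In the online setting with lookahead $\ell = 3r - 1$, any number of loads $n \le rc$ (i.e. up to the maximum capacity), with any arrival sequence $A$ and departure sequence $D=(1,\dots,n)$, can be stored in the order $A$ and subsequently retrieved in the order $D$ without relocations, by an algorithm running in $O(n \log r)$ time. Furthermore, this can be done so that all access paths (the paths used to store and retrieve loads) are column-adjacent.
   Context: Storage area: a rectangular grid $W$ with $r$ rows and $c$ columns; the bottom row (front row) is the only side through which loads enter and leave. There are $n \le rc$ loads with distinct labels $1,\dots,n$, each occupying exactly one cell; no two loads share a cell. A load moves only along paths of horizontally/vertically adjacent cells (moves up, down, left, right) that are currently empty (apart from the load's own starting cell). Actions: (Storage) an arriving load is placed in an empty cell $v$ via a path from any cell of the front row to $v$. (Retrieval) a load is removed via a path from its current cell to any cell of the front row. (Relocation) a load is moved inside $W$ from its current cell to an empty cell $v$ via a path, where $v$ and the original cell must be accessible from the front row. Loads arrive one at a time in the order $A=(a_1,\dots,a_n)$ (a permutation of $\{1,\dots,n\}$), each being stored before the next arrives; after all are stored, they are retrieved in the order of the departure sequence $D$, fixed to be $(1,\dots,n)$ by relabeling. "Without relocations" means exactly one storage action and one retrieval action per load ($2n$ actions in total). Online setting with lookahead $\ell$: when a load $a_t$ is to be stored, only the next $\ell$ arriving loads $a_t, a_{t+1},\dots,a_{t+\ell-1}$ (as far as they exist) are known, besides the past arrivals; the departure sequence $D$ is fully known (so $n$ and the position of each known load in $D$ are known). Column-adjacent path: a path between the front row and a cell that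 lies in a single column, with a possible additional short lateral segment to a cell (the load's cell) horizontally adjacent to that column. *)

theory Defs
  imports Complex_Main
begin

text \<open>A cell is a pair (row, column), both counted from 0; row 0 is the front row.
  A configuration maps each stored load to its cell.\<close>

type_synonym cell = "nat \<times> nat"
type_synonym path = "cell list"
type_synonym config = "nat \<rightharpoonup> cell"

definition grid :: "nat \<Rightarrow> nat \<Rightarrow> cell set" where
  "grid r c = {0..<r} \<times> {0..<c}"

definition adj :: "cell \<Rightarrow> cell \<Rightarrow> bool" where
  "adj u v \<longleftrightarrow>
     (fst u = fst v \<and> (snd u = Suc (snd v) \<or> snd v = Suc (snd u))) \<or>
     (snd u = snd v \<and> (fst u = Suc (fst v) \<or> fst v = Suc (fst u)))"

definition front :: "cell \<Rightarrow> bool" where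
  "front v \<longleftrightarrow> fst v = 0"

definition free_path :: "nat \<Rightarrow> nat \<Rightarrow> cell set \<Rightarrow> path \<Rightarrow> bool" where
  "free_path r c occ p \<longleftrightarrow>
     p \<noteq> [] \<and> set p \<subseteq> grid r c - occ \<and>
     (\<forall>i. Suc i < length p \<longrightarrow> adj (p ! i) (p ! Suc i))"

definition accessible :: "nat \<Rightarrow> nat \<Rightarrow> cell set \<Rightarrow> cell \<Rightarrow> bool" where
  "accessible r c occ v \<longleftrightarrow> (\<exists>p. free_path r c occ p \<and> front (hd p) \<and> last p = v)"

datatype action =
    Store nat path
  | Retrieve nat path
  | Relocate nat path

text \<open>When load \<open>x\<close> moves, its own cell does not count as occupied, hence \<open>pos(x := None)\<close>.\<close>

inductive act_step :: "nat \<Rightarrow> nat \<Rightarrow> config \<Rightarrow> action \<Rightarrow> config \<Rightarrow> bool" for r c where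
  store: "\<lbrakk>x \<notin> dom pos; free_path r c (ran pos) p; front (hd p)\<rbrakk>
    \<Longrightarrow> act_step r c pos (Store x p) (pos(x \<mapsto> last p))"
| retrieve: "\<lbrakk>pos x = Some (hd p); free_path r c (ran (pos(x := None))) p; front (last p)\<rbrakk>
    \<Longrightarrow> act_step r c pos (Retrieve x p) (pos(x := None))"
| relocate: "\<lbrakk>pos x = Some (hd p); last p \<noteq> hd p; free_path r c (ran (pos(x := None))) p;
      accessible r c (ran (pos(x := None))) (hd p);
      accessible r c (ran (pos(x := None))) (last p)\<rbrakk>
    \<Longrightarrow> act_step r c pos (Relocate x p) (pos(x \<mapsto> last p))"

inductive executes :: "nat \<Rightarrow> nat \<Rightarrow> config \<Rightarrow> action list \<Rightarrow> config \<Rightarrow> bool" for r c where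
  "executes r c pos [] pos"
| "\<lbrakk>act_step r c pos a pos'; executes r c pos' as pos''\<rbrakk>
    \<Longrightarrow> executes r c pos (a # as) pos''"

datatype event = Arrives nat | Departs nat

fun events :: "action list \<Rightarrow> event list" where
  "events [] = []"
| "events (Store x p # as) = Arrives x # events as"
| "events (Retrieve x p # as) = Departs x # events as"
| "events (Relocate x p # as) = events as"

definition serves :: "nat \<Rightarrow> nat \<Rightarrow> nat list \<Rightarrow> action list \<Rightarrow> bool" where
  "serves r c A as \<longleftrightarrow>
     executes r c Map.empty as Map.empty \<and>
     events as = map Arrives A @ map Departs [1..<Suc (length A)]"

definition without_relocations :: "action list \<Rightarrow> bool" where
  "without_relocations as \<longleftrightarrow> (\<forall>x p. Relocate x p \<notin> set as)"

text \<open>\<open>p\<close> is read from the front row to the cell of the load; only that cell may lie outside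
  column \<open>j\<close>.\<close>

definition column_adjacent :: "path \<Rightarrow> bool" where
  "column_adjacent p \<longleftrightarrow>
     (\<exists>j q v. q \<noteq> [] \<and> (\<forall>u\<in>set q. snd u = j) \<and>
        (p = q \<or> (p = q @ [v] \<and> fst v = fst (last q) \<and> adj (last q) v)))"

definition column_adjacent_access :: "action list \<Rightarrow> bool" where
  "column_adjacent_access as \<longleftrightarrow>
     (\<forall>x p. Store x p \<in> set as \<longrightarrow> column_adjacent p) \<and>
     (\<forall>x p. Retrieve x p \<in> set as \<longrightarrow> column_adjacent (rev p))"

text \<open>Algorithms are programs of a word RAM: scalar variables and arrays of natural numbers, all
  initially 0 except for the inputs \<open>r\<close>, \<open>c\<close> and \<open>n\<close>. Every operation costs one time unit, and
  assigned values and the indices of array assignments must be below a word bound \<open>B\<close>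
  (which justifies unit cost for multiplication and division).\<close>

datatype aexp =
    Num nat
  | Var string
  | Arr string aexp
  | Add aexp aexp
  | Sub aexp aexp
  | Mul aexp aexp
  | Quot aexp aexp

datatype bexp =
    Less aexp aexp
  | Eq aexp aexp
  | Neg bexp
  | Conj bexp bexp

record mstate =
  scal :: "string \<Rightarrow> nat"
  arr :: "string \<Rightarrow> nat \<Rightarrow> nat"
  nread :: nat
  nstored :: nat
  plan :: "action list"

fun aval :: "aexp \<Rightarrow> mstate \<Rightarrow> nat" where
  "aval (Num k) s = k"
| "aval (Var x) s = scal s x"
| "aval (Arr a e) s = arr s a (aval e s)"
| "aval (Add e f) s = aval e s + aval f s"
| "aval (Sub e f) s = aval e s - aval f s"
| "aval (Mul e f) s = aval e s * aval f s"
| "aval (Quot e f) s = aval e s div aval f s"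

fun acost :: "aexp \<Rightarrow> nat" where
  "acost (Num k) = 1"
| "acost (Var x) = 1"
| "acost (Arr a e) = 1 + acost e"
| "acost (Add e f) = 1 + acost e + acost f"
| "acost (Sub e f) = 1 + acost e + acost f"
| "acost (Mul e f) = 1 + acost e + acost f"
| "acost (Quot e f) = 1 + acost e + acost f"

fun bval :: "bexp \<Rightarrow> mstate \<Rightarrow> bool" where
  "bval (Less e f) s \<longleftrightarrow> aval e s < aval f s"
| "bval (Eq e f) s \<longleftrightarrow> aval e s = aval f s"
| "bval (Neg b) s \<longleftrightarrow> \<not> bval b s"
| "bval (Conj b d) s \<longleftrightarrow> bval b s \<and> bval d s"

fun bcost :: "bexp \<Rightarrow> nat" where
  "bcost (Less e f) = 1 + acost e + acost f"
| "bcost (Eq e f) = 1 + acost e + acost f"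
| "bcost (Neg b) = 1 + bcost b"
| "bcost (Conj b d) = 1 + bcost b + bcost d"

text \<open>A program describes the path of an action by its corners, since the running time would not
  allow for listing all its cells. \<open>leg u v\<close> lists the cells after \<open>u\<close> on the way from \<open>u\<close> to \<open>v\<close>,
  first along the column of \<open>u\<close> and then along the row of \<open>v\<close>; for two corners in a common row or
  column it is the straight segment.\<close>

definition walk :: "nat \<Rightarrow> nat \<Rightarrow> nat list" where
  "walk i k = (if i \<le> k then [Suc i..<Suc k] else rev [k..<i])"

definition leg :: "cell \<Rightarrow> cell \<Rightarrow> path" where
  "leg u v = map (\<lambda>i. (i, snd u)) (walk (fst u) (fst v)) @
             map (\<lambda>j. (fst v, j)) (walk (snd u) (snd v))"

fun legs :: "cell \<Rightarrow> cell list \<Rightarrow> path" where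
  "legs u [] = []"
| "legs u (v # vs) = leg u v @ legs v vs"

fun trace :: "cell list \<Rightarrow> path" where
  "trace [] = []"
| "trace (u # us) = u # legs u us"

text \<open>\<open>Next x\<close> reads the next arriving load into \<open>x\<close>. \<open>DoStore\<close> stores the load whose turn it is;
  \<open>DoRetrieve\<close> and \<open>DoRelocate\<close> name their load. Corners are (row, column) pairs.\<close>

datatype com =
    Skip
  | Assign string aexp
  | AssignArr string aexp aexp
  | Seq com com
  | If bexp com com
  | While bexp com
  | Next string
  | DoStore "(aexp \<times> aexp) list"
  | DoRetrieve aexp "(aexp \<times> aexp) list"
  | DoRelocate aexp "(aexp \<times> aexp) list"

definition cval :: "(aexp \<times> aexp) list \<Rightarrow> mstate \<Rightarrow> cell list" where
  "cval us s = map (\<lambda>(e, f). (aval e s, aval f s)) us"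

definition ccost :: "(aexp \<times> aexp) list \<Rightarrow> nat" where
  "ccost us = sum_list (map (\<lambda>(e, f). acost e + acost f) us)"

text \<open>\<open>run l A B C s t s'\<close>: with lookahead \<open>l\<close>, arrival sequence \<open>A\<close> and word bound \<open>B\<close>, program
  \<open>C\<close> leads from \<open>s\<close> to \<open>s'\<close> in time \<open>t\<close>. While \<open>A ! m\<close> is the load to be stored, exactly
  \<open>A ! 0, \<dots>, A ! (m + l - 1)\<close> are available for reading (as far as they exist); apart from
  \<open>DoStore\<close>, which records the load that is stored, the semantics uses \<open>A\<close> in no other way.\<close>

inductive run :: "nat \<Rightarrow> nat list \<Rightarrow> nat \<Rightarrow> com \<Rightarrow> mstate \<Rightarrow> nat \<Rightarrow> mstate \<Rightarrow> bool"
  for l A B where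
  Skip: "run l A B Skip s 1 s"
| Assign: "aval e s < B
    \<Longrightarrow> run l A B (Assign x e) s (1 + acost e) (s\<lparr>scal := (scal s)(x := aval e s)\<rparr>)"
| AssignArr: "\<lbrakk>aval e s < B; aval f s < B\<rbrakk>
    \<Longrightarrow> run l A B (AssignArr a e f) s (1 + acost e + acost f)
          (s\<lparr>arr := (arr s)(a := (arr s a)(aval e s := aval f s))\<rparr>)"
| Seq: "\<lbrakk>run l A B C1 s t1 s'; run l A B C2 s' t2 s''\<rbrakk>
    \<Longrightarrow> run l A B (Seq C1 C2) s (t1 + t2) s''"
| IfTrue: "\<lbrakk>bval b s; run l A B C1 s t s'\<rbrakk>
    \<Longrightarrow> run l A B (If b C1 C2) s (1 + bcost b + t) s'"
| IfFalse: "\<lbrakk>\<not> bval b s; run l A B C2 s t s'\<rbrakk>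
    \<Longrightarrow> run l A B (If b C1 C2) s (1 + bcost b + t) s'"
| WhileFalse: "\<not> bval b s \<Longrightarrow> run l A B (While b C) s (1 + bcost b) s"
| WhileTrue: "\<lbrakk>bval b s; run l A B C s t1 s'; run l A B (While b C) s' t2 s''\<rbrakk>
    \<Longrightarrow> run l A B (While b C) s (1 + bcost b + t1 + t2) s''"
| Next: "\<lbrakk>nread s < length A; nread s < nstored s + l; A ! nread s < B\<rbrakk>
    \<Longrightarrow> run l A B (Next x) s 1
          (s\<lparr>scal := (scal s)(x := A ! nread s), nread := Suc (nread s)\<rparr>)"
| DoStore: "nstored s < length A
    \<Longrightarrow> run l A B (DoStore us) s (1 + ccost us)
          (s\<lparr>nstored := Suc (nstored s),
             plan := plan s @ [Store (A ! nstored s) (trace (cval us s))]\<rparr>)"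
| DoRetrieve: "run l A B (DoRetrieve e us) s (1 + acost e + ccost us)
    (s\<lparr>plan := plan s @ [Retrieve (aval e s) (trace (cval us s))]\<rparr>)"
| DoRelocate: "run l A B (DoRelocate e us) s (1 + acost e + ccost us)
    (s\<lparr>plan := plan s @ [Relocate (aval e s) (trace (cval us s))]\<rparr>)"

definition init :: "nat \<Rightarrow> nat \<Rightarrow> nat \<Rightarrow> mstate" where
  "init r c n =
     \<lparr>scal = (\<lambda>_. 0)(''r'' := r, ''c'' := c, ''n'' := n), arr = (\<lambda>_ _. 0),
      nread = 0, nstored = 0, plan = []\<rparr>"

text \<open>For fixed \<open>k\<close> these are words of \<open>O(log (r * c))\<close> bits.\<close>

definition word_bound :: "nat \<Rightarrow> nat \<Rightarrow> nat \<Rightarrow> nat" where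
  "word_bound k r c = (r * c + 2) ^ k"

end

theory Submission
  imports Defs
begin

text \<open>
  Replacing \<open>r\<close> by \<open>h = min r n\<close>, the loads are taken in groups of \<open>h\<close> in the order of arrival.
  As long as more than three columns are free, the next group is sorted by departure and fills the
  next column with the earliest departure in front: each load enters through the empty column to the
  right and leaves along its own column. At most \<open>3 * h\<close> loads then remain for three columns
  \<open>L, M, R\<close>. The lookahead shows all of them but one, and that one follows from the sum of all labels.

  Let \<open>x\<close> be the first remaining load to depart and \<open>y\<close> the last one to arrive. If \<open>x \<noteq> y\<close>, then
  \<open>x\<close> and \<open>y\<close> get the foremost free cells of \<open>L\<close> and of \<open>M\<close>; both enter through \<open>M\<close>, which is only
  filled in front of them by loads arriving later than \<open>y\<close>, and both leave through \<open>L\<close>, whose loads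
  further to the front depart earlier than \<open>x\<close>. If \<open>x = y\<close>, the load goes to \<open>R\<close>, which then is a
  stack in both orders. Once \<open>L\<close> and \<open>M\<close> are full, the remaining loads enter \<open>R\<close> through \<open>M\<close>, sorted by
  departure. Once \<open>R\<close> is full instead, its loads arrive after and depart before all remaining ones,
  so that the last arrivals fill \<open>M\<close> and leave through \<open>R\<close>, and the others are sorted into \<open>L\<close> through
  \<open>M\<close>.

  Sorting by a bottom-up merge sort determines the running time.
\<close>

section \<open>Weakest preconditions with running time\<close>

text \<open>The obstacle is that cells in the last three columns are assigned neither in arrival nor
  in departure order: each assignment takes a load that is extreme in one of these orders among the
  loads still without a cell. Following the storage area through time would give no usable
  invariant. Instead, \<open>valid\<close> compares loads pairwise and without reference to time; it
  can be maintained while one load after another receives its cell, and it implies that all actions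
  can be executed.

  The delicate moment lies between the two assignments of a pair \<open>x\<close>, \<open>y\<close>:
  then \<open>L\<close> is one cell ahead of \<open>M\<close>, and the load in that cell will enter
  across a cell of \<open>M\<close> that is still to be filled. The pending load \<open>y\<close>
  guarantees that a load arriving later goes there.

  The factor is log r rather than log n because at most \<open>3 * h\<close> keys are sorted at a
  time and the groups have total size \<open>n\<close>. Finding \<open>x\<close> and
  \<open>y\<close> is amortized: two pointers run monotonically over the departure order and the
  arrival order and skip loads that already have a cell.\<close>

definition wp :: "nat \<Rightarrow> nat list \<Rightarrow> nat \<Rightarrow> com \<Rightarrow> (nat \<Rightarrow> mstate \<Rightarrow> bool) \<Rightarrow> mstate \<Rightarrow> bool" where
  "wp l A B C Q s \<longleftrightarrow> (\<exists>t s'. run l A B C s t s' \<and> Q t s')"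

lemma wp_simps:
  "wp l A B Skip Q s \<longleftrightarrow> Q 1 s"
  "wp l A B (Assign x e) Q s \<longleftrightarrow>
     aval e s < B \<and> Q (1 + acost e) (s\<lparr>scal := (scal s)(x := aval e s)\<rparr>)"
  "wp l A B (AssignArr a e f) Q s \<longleftrightarrow>
     aval e s < B \<and> aval f s < B \<and>
     Q (1 + acost e + acost f) (s\<lparr>arr := (arr s)(a := (arr s a)(aval e s := aval f s))\<rparr>)"
  "wp l A B (Seq C1 C2) Q s \<longleftrightarrow>
     wp l A B C1 (\<lambda>t1 s1. wp l A B C2 (\<lambda>t2 s2. Q (t1 + t2) s2) s1) s"
  "wp l A B (If b C1 C2) Q s \<longleftrightarrow>
     (bval b s \<longrightarrow> wp l A B C1 (\<lambda>t. Q (1 + bcost b + t)) s) \<and>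
     (\<not> bval b s \<longrightarrow> wp l A B C2 (\<lambda>t. Q (1 + bcost b + t)) s)"
  "wp l A B (Next x) Q s \<longleftrightarrow>
     nread s < length A \<and> nread s < nstored s + l \<and> A ! nread s < B \<and>
     Q 1 (s\<lparr>scal := (scal s)(x := A ! nread s), nread := Suc (nread s)\<rparr>)"
  "wp l A B (DoStore us) Q s \<longleftrightarrow>
     nstored s < length A \<and>
     Q (1 + ccost us) (s\<lparr>nstored := Suc (nstored s),
       plan := plan s @ [Store (A ! nstored s) (trace (cval us s))]\<rparr>)"
  "wp l A B (DoRetrieve e us) Q s \<longleftrightarrow>
     Q (1 + acost e + ccost us)
       (s\<lparr>plan := plan s @ [Retrieve (aval e s) (trace (cval us s))]\<rparr>)"
  subgoal unfolding wp_def by (subst run.simps) auto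
  subgoal unfolding wp_def by (subst run.simps) auto
  subgoal unfolding wp_def by (subst run.simps) auto
  subgoal unfolding wp_def by (subst run.simps) (simp, blast)
  subgoal unfolding wp_def by (subst run.simps) (cases "bval b s"; simp; blast)
  subgoal unfolding wp_def by (subst run.simps) auto
  subgoal unfolding wp_def by (subst run.simps) auto
  subgoal unfolding wp_def by (subst run.simps) auto
  done

lemma wp_conseq:
  assumes "wp l A B C Q s" "\<And>t s'. Q t s' \<Longrightarrow> Q' t s'"
  shows "wp l A B C Q' s"
  using assms unfolding wp_def by blast

section \<open>Frame conditions: what a program leaves unchanged\<close>

fun mvars :: "com \<Rightarrow> string set" where
  "mvars (Assign x e) = {x}"
| "mvars (Next x) = {x}"
| "mvars (Seq C D) = mvars C \<union> mvars D"
| "mvars (If b C D) = mvars C \<union> mvars D"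
| "mvars (While b C) = mvars C"
| "mvars _ = {}"

fun marrs :: "com \<Rightarrow> string set" where
  "marrs (AssignArr a e f) = {a}"
| "marrs (Seq C D) = marrs C \<union> marrs D"
| "marrs (If b C D) = marrs C \<union> marrs D"
| "marrs (While b C) = marrs C"
| "marrs _ = {}"

fun reads :: "com \<Rightarrow> bool" where
  "reads (Next x) = True"
| "reads (Seq C D) = (reads C \<or> reads D)"
| "reads (If b C D) = (reads C \<or> reads D)"
| "reads (While b C) = reads C"
| "reads _ = False"

fun acts :: "com \<Rightarrow> bool" where
  "acts (DoStore us) = True"
| "acts (DoRetrieve e us) = True"
| "acts (DoRelocate e us) = True"
| "acts (Seq C D) = (acts C \<or> acts D)"
| "acts (If b C D) = (acts C \<or> acts D)"
| "acts (While b C) = acts C"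
| "acts _ = False"

definition same :: "com \<Rightarrow> mstate \<Rightarrow> mstate \<Rightarrow> bool" where
  "same C s s' \<longleftrightarrow>
     (\<forall>x. x \<notin> mvars C \<longrightarrow> scal s' x = scal s x) \<and>
     (\<forall>a. a \<notin> marrs C \<longrightarrow> arr s' a = arr s a) \<and>
     (\<not> reads C \<longrightarrow> nread s' = nread s) \<and>
     (\<not> acts C \<longrightarrow> nstored s' = nstored s \<and> plan s' = plan s)"

lemma same_refl: "same C s s"
  by (simp add: same_def)

lemma same_trans: "same C s s' \<Longrightarrow> same C s' s'' \<Longrightarrow> same C s s''"
  by (simp add: same_def)

lemma run_same: "run l A B C s t s' \<Longrightarrow> same C s s'"
  by (induction rule: run.induct) (auto simp: same_def)

lemma same_While: "same (While b C) = same C"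
  by (simp add: same_def fun_eq_iff)

lemma wp_same: "wp l A B C Q s \<Longrightarrow> wp l A B C (\<lambda>t s'. Q t s' \<and> same C s s') s"
  unfolding wp_def using run_same by blast

text \<open>The potential \<open>\<Phi>\<close> bounds the number of iterations and so turns the
  bound \<open>T\<close> for one iteration into a bound for the loop. Handing
  \<open>same C s0 s\<close> to the step lets an invariant omit whatever the body cannot
  modify.\<close>

lemma wp_while:
  assumes "I s0"
    and step: "\<And>s. I s \<Longrightarrow> same C s0 s \<Longrightarrow> bval b s \<Longrightarrow>
      wp l A B C (\<lambda>t s'. t \<le> T \<and> I s' \<and> \<Phi> s' < (\<Phi> s :: nat)) s"
  shows "wp l A B (While b C) (\<lambda>t s'. t \<le> \<Phi> s0 * (1 + bcost b + T) + (1 + bcost b) \<and>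
      I s' \<and> \<not> bval b s' \<and> same C s0 s') s0"
proof -
  have "wp l A B (While b C) (\<lambda>t s'. t \<le> \<Phi> s * (1 + bcost b + T) + (1 + bcost b) \<and>
      I s' \<and> \<not> bval b s') s" if "I s" "same C s0 s" for s
    using that
  proof (induction "\<Phi> s" arbitrary: s rule: less_induct)
    case less
    show ?case
    proof (cases "bval b s")
      case False
      then show ?thesis
        using less.prems unfolding wp_def by (intro exI conjI) (rule run.WhileFalse, auto)
    next
      case True
      obtain t s' where 1: "run l A B C s t s'" "t \<le> T" "I s'" "\<Phi> s' < \<Phi> s"
        using step[OF less.prems True] unfolding wp_def by blast
      have "same C s0 s'"
        using run_same[OF 1(1)] less.prems same_trans by blast
      from less.hyps[OF 1(4) 1(3) this] obtain t2 s2 where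
        2: "run l A B (While b C) s' t2 s2" "t2 \<le> \<Phi> s' * (1 + bcost b + T) + (1 + bcost b)"
           "I s2" "\<not> bval b s2"
        unfolding wp_def by blast
      have "Suc (\<Phi> s') * (1 + bcost b + T) \<le> \<Phi> s * (1 + bcost b + T)"
        using 1(4) by (intro mult_right_mono) auto
      then have "1 + bcost b + t + t2 \<le> \<Phi> s * (1 + bcost b + T) + (1 + bcost b)"
        using 1(2) 2(2) by simp
      then show ?thesis
        unfolding wp_def using run.WhileTrue[OF True 1(1) 2(1)] 2(3,4) by blast
    qed
  qed
  from wp_same[OF this[OF assms(1) same_refl]] show ?thesis
    by (rule wp_conseq) (simp add: same_While)
qed

abbreviation seq (infixr ";;" 61) where "C1 ;; C2 \<equiv> Seq C1 C2"
abbreviation assign (infix "::=" 62) where "x ::= e \<equiv> Assign x e"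

text \<open>The counting loops all run up to \<open>m\<close>, the size of the current group of
  loads, so that one rule covers reading, merging, placing and storing.\<close>

definition loop :: "string \<Rightarrow> com \<Rightarrow> com" where
  "loop i C = (i ::= Num 0 ;; While (Less (Var i) (Var ''m'')) (C ;; i ::= Add (Var i) (Num 1)))"

text \<open>The index of \<open>J\<close> replaces the counter, hence \<open>upd\<close>:
  \<open>J\<close> itself must not depend on the variable \<open>i\<close>. Of the constant 8, the
  test takes 4 and the increment 4; the first assignment and the last test are paid by the summand
  \<open>+ 1\<close>.\<close>

lemma wp_loop:
  assumes "J 0 s0" "B > scal s0 ''m''" "i \<noteq> ''m''" "''m'' \<notin> mvars C" "i \<notin> mvars C"
    and upd: "\<And>k s v. J k s \<Longrightarrow> J k (s\<lparr>scal := (scal s)(i := v)\<rparr>)"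
    and step: "\<And>k s. J k s \<Longrightarrow> same (loop i C) s0 s \<Longrightarrow> scal s i = k \<Longrightarrow> k < scal s0 ''m'' \<Longrightarrow>
      wp l A B C (\<lambda>t s'. t \<le> T \<and> J (Suc k) s') s"
  shows "wp l A B (loop i C) (\<lambda>t s'. t \<le> (T + 8) * (scal s0 ''m'' + 1) \<and>
      J (scal s0 ''m'') s' \<and> same (loop i C) s0 s') s0"
proof -
  define N where "N = scal s0 ''m''"
  define D where "D = (C ;; i ::= Add (Var i) (Num 1))"
  define b where "b = Less (Var i) (Var ''m'')"
  let ?s = "s0\<lparr>scal := (scal s0)(i := 0)\<rparr>"
  have sD: "same (loop i C) s0 s" if "same D ?s s" for s
    using that unfolding same_def loop_def D_def by auto
  have "wp l A B (While b D) (\<lambda>t s'. t \<le> (N - scal ?s i) * (1 + bcost b + (T + 4)) + (1 + bcost b) \<and>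
      (scal s' i \<le> N \<and> J (scal s' i) s') \<and> \<not> bval b s' \<and> same D ?s s') ?s"
  proof (rule wp_while[where \<Phi> = "\<lambda>s. N - scal s i" and I = "\<lambda>s. scal s i \<le> N \<and> J (scal s i) s"])
    show "scal ?s i \<le> N \<and> J (scal ?s i) ?s"
      using upd[OF assms(1)] by simp
  next
    fix s assume I: "scal s i \<le> N \<and> J (scal s i) s" and sm: "same D ?s s" and "bval b s"
    moreover have m: "scal s ''m'' = N"
      using sm assms(3,4) unfolding same_def D_def N_def by auto
    ultimately have lt: "scal s i < N"
      by (auto simp: b_def)
    have "wp l A B C (\<lambda>t s'. (t \<le> T \<and> J (Suc (scal s i)) s') \<and> same C s s') s"
      by (rule wp_same, rule step) (use I sD[OF sm] lt N_def in auto)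
    then have "wp l A B C (\<lambda>t s'. t \<le> T \<and> J (Suc (scal s i)) s' \<and> scal s' i = scal s i) s"
      by (rule wp_conseq) (use assms(5) in \<open>auto simp: same_def\<close>)
    then show "wp l A B D (\<lambda>t s'. t \<le> T + 4 \<and> (scal s' i \<le> N \<and> J (scal s' i) s') \<and>
        N - scal s' i < N - scal s i) s"
      unfolding D_def wp_simps
      by (rule wp_conseq) (use lt assms(2) N_def upd in \<open>auto simp: diff_less_mono2\<close>)
  qed
  then show ?thesis
    unfolding loop_def wp_simps D_def[symmetric] b_def[symmetric] N_def[symmetric]
    apply (intro conjI)
    subgoal using assms(2) by simp
    apply simp
    apply (erule wp_conseq)
    subgoal premises a for t s'
    proof -
      have "scal s' ''m'' = N"
        using a assms(3,4) unfolding same_def D_def N_def by auto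
      then have e: "scal s' i = N" using a by (auto simp: b_def)
      have "bcost b = 3" by (simp add: b_def)
      then have "2 + t \<le> (T + 8) * (N + 1)" using a by (simp add: algebra_simps)
      then show ?thesis using a e sD[of s'] unfolding loop_def D_def b_def by simp
    qed
    done
qed

section \<open>Plans from placements\<close>

definition nearby :: "nat \<Rightarrow> nat \<Rightarrow> bool" where
  "nearby j k \<longleftrightarrow> k = j \<or> k = Suc j \<or> j = Suc k"

definition access_path :: "nat \<Rightarrow> nat \<Rightarrow> nat \<Rightarrow> path" where
  "access_path i j k = map (\<lambda>t. (t, j)) [0..<Suc i] @ (if k = j then [] else [(i, k)])"

text \<open>Three corners serve for a cell beside the column as well as for a cell in it, since the
  leg between equal corners is empty.\<close>

lemma trace_in: "nearby j k \<Longrightarrow> trace [(0, j), (i, j), (i, k)] = access_path i j k"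
  using upt_conv_Cons[of 0 "Suc i"]
  by (auto simp: nearby_def access_path_def leg_def walk_def simp del: upt_Suc)
    (auto simp: upt_Suc)

lemma trace_out: "nearby j k \<Longrightarrow> trace [(i, k), (i, j), (0, j)] = rev (access_path i j k)"
  by (auto simp: nearby_def access_path_def leg_def walk_def rev_map)

lemma column_adjacent_access_path: "nearby j k \<Longrightarrow> column_adjacent (access_path i j k)"
  unfolding column_adjacent_def
  by (rule exI[of _ j], rule exI[of _ "map (\<lambda>t. (t, j)) [0..<Suc i]"], rule exI[of _ "(i, k)"])
    (auto simp: access_path_def nearby_def adj_def)

lemma last_access_path: "last (access_path i j k) = (i, k)"
  by (auto simp: access_path_def)

lemma hd_access_path: "hd (access_path i j k) = (0, j)"
  using upt_conv_Cons[of 0 "Suc i"] by (simp add: access_path_def del: upt_Suc)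

lemma access_path_nonempty: "access_path i j k \<noteq> []"
  by (auto simp: access_path_def)

lemma set_access_path: "set (access_path i j k) = {0..i} \<times> {j} \<union> {(i, k)}"
  by (auto simp: access_path_def)

lemma free_access_path:
  assumes "nearby j k" "set (access_path i j k) \<subseteq> grid r c - occ"
  shows "free_path r c occ (access_path i j k)"
  unfolding free_path_def
proof (intro conjI allI impI)
  fix m assume m: "Suc m < length (access_path i j k)"
  have 1: "access_path i j k ! t = (t, j)" if "t \<le> i" for t
    using that by (simp add: access_path_def nth_append del: upt_Suc)
  have 2: "access_path i j k ! Suc i = (i, k)" "m = i \<Longrightarrow> k \<noteq> j" "m \<le> i" if "m \<ge> i"
    using that m by (simp_all add: access_path_def nth_append del: upt_Suc split: if_splits)
  show "adj (access_path i j k ! m) (access_path i j k ! Suc m)"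
  proof (cases "m < i")
    case True
    then show ?thesis by (simp add: 1 adj_def)
  next
    case False
    then have "m = i" "k \<noteq> j" using 2 by auto
    then show ?thesis using 1[of i] 2(1) assms(1) by (auto simp: adj_def nearby_def)
  qed
qed (use assms in \<open>auto simp: access_path_nonempty\<close>)

lemma free_path_rev:
  assumes "free_path r c occ p"
  shows "free_path r c occ (rev p)"
  unfolding free_path_def
proof (intro conjI allI impI)
  fix m assume m: "Suc m < length (rev p)"
  have adj_sym: "adj u v \<Longrightarrow> adj v u" for u v
    by (auto simp: adj_def)
  have "adj (p ! (length p - Suc (Suc m))) (p ! Suc (length p - Suc (Suc m)))"
    using assms m unfolding free_path_def by auto
  moreover have "Suc (length p - Suc (Suc m)) = length p - Suc m"
    using m by auto
  ultimately show "adj (rev p ! m) (rev p ! Suc m)"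
    using m by (simp add: rev_nth adj_sym)
qed (use assms in \<open>auto simp: free_path_def\<close>)

text \<open>Load \<open>x\<close> has the cell \<open>(rw x, cl x)\<close>; it enters through column \<open>en x\<close>, leaves through
  column \<open>ex x\<close>, and is the \<open>a x\<close>-th load to arrive. The two implications say that nothing
  obstructs the access paths.\<close>

definition valid :: "(nat \<Rightarrow> nat) \<Rightarrow> nat set \<Rightarrow>
    (nat \<Rightarrow> nat) \<Rightarrow> (nat \<Rightarrow> nat) \<Rightarrow> (nat \<Rightarrow> nat) \<Rightarrow> (nat \<Rightarrow> nat) \<Rightarrow> bool" where
  "valid a P rw cl en ex \<longleftrightarrow>
     (\<forall>x\<in>P. \<forall>z\<in>P. x \<noteq> z \<longrightarrow>
        (rw x, cl x) \<noteq> (rw z, cl z) \<and>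
        (cl z = en x \<and> rw z \<le> rw x \<longrightarrow> a x < a z) \<and>
        (cl z = ex x \<and> rw z \<le> rw x \<longrightarrow> z < x))"

definition fits :: "nat \<Rightarrow> nat \<Rightarrow> nat set \<Rightarrow>
    (nat \<Rightarrow> nat) \<Rightarrow> (nat \<Rightarrow> nat) \<Rightarrow> (nat \<Rightarrow> nat) \<Rightarrow> (nat \<Rightarrow> nat) \<Rightarrow> bool" where
  "fits r c P rw cl en ex \<longleftrightarrow>
     (\<forall>x\<in>P. rw x < r \<and> cl x < c \<and> en x < c \<and> ex x < c \<and>
        nearby (en x) (cl x) \<and> nearby (ex x) (cl x))"

definition store_act :: "(nat \<Rightarrow> nat) \<Rightarrow> (nat \<Rightarrow> nat) \<Rightarrow> (nat \<Rightarrow> nat) \<Rightarrow> nat \<Rightarrow> action" where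
  "store_act rw cl en x = Store x (trace [(0, en x), (rw x, en x), (rw x, cl x)])"

definition retrieve_act :: "(nat \<Rightarrow> nat) \<Rightarrow> (nat \<Rightarrow> nat) \<Rightarrow> (nat \<Rightarrow> nat) \<Rightarrow> nat \<Rightarrow> action" where
  "retrieve_act rw cl ex x = Retrieve x (trace [(rw x, cl x), (rw x, ex x), (0, ex x)])"

definition stored :: "(nat \<Rightarrow> nat) \<Rightarrow> (nat \<Rightarrow> nat) \<Rightarrow> nat set \<Rightarrow> config" where
  "stored rw cl X = (\<lambda>x. if x \<in> X then Some (rw x, cl x) else None)"

lemma ran_stored: "ran (stored rw cl X) = (\<lambda>x. (rw x, cl x)) ` X"
  by (auto simp: stored_def ran_def)

lemma executes_append:
  "executes r c p as p' \<Longrightarrow> executes r c p' bs p'' \<Longrightarrow> executes r c p (as @ bs) p''"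
  by (induction rule: executes.induct) (auto intro: executes.intros)

text \<open>A load on the path would occupy the target cell or stand in the entry column no deeper
  than the target row. \<open>valid\<close> excludes the former; in the latter case the load arrives
  after \<open>x\<close> and is not yet stored.\<close>

lemma act_step_store:
  assumes v: "valid a P rw cl en ex" and f: "fits r c P rw cl en ex"
    and X: "X \<subseteq> P" "x \<in> P" "x \<notin> X" "\<And>z. z \<in> X \<Longrightarrow> a z < a x"
  shows "act_step r c (stored rw cl X) (store_act rw cl en x) (stored rw cl (insert x X))"
proof -
  have nb: "nearby (en x) (cl x)" and g: "rw x < r" "cl x < c" "en x < c"
    using f X(2) by (auto simp: fits_def)
  let ?p = "access_path (rw x) (en x) (cl x)"
  have "set ?p \<inter> (\<lambda>x. (rw x, cl x)) ` X = {}"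
  proof (rule ccontr)
    assume "set ?p \<inter> (\<lambda>x. (rw x, cl x)) ` X \<noteq> {}"
    then obtain z where z: "z \<in> X" "(rw z, cl z) \<in> set ?p"
      by blast
    have "z \<in> P" "x \<noteq> z"
      using X z by auto
    with v X(2) have "(rw x, cl x) \<noteq> (rw z, cl z)" "cl z = en x \<and> rw z \<le> rw x \<longrightarrow> a x < a z"
      unfolding valid_def by blast+
    moreover have "a z < a x"
      using X z by auto
    ultimately show False
      using z(2) by (auto simp: set_access_path)
  qed
  then have "free_path r c (ran (stored rw cl X)) ?p"
    using g by (intro free_access_path nb) (auto simp: ran_stored set_access_path grid_def)
  moreover have "x \<notin> dom (stored rw cl X)"
    using X by (auto simp: stored_def dom_def)
  moreover have "(stored rw cl X)(x \<mapsto> last ?p) = stored rw cl (insert x X)"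
    by (auto simp: stored_def last_access_path)
  ultimately show ?thesis
    using act_step.store[of x "stored rw cl X" r c ?p]
    unfolding store_act_def trace_in[OF nb] by (simp add: hd_access_path front_def)
qed

text \<open>Dual to storing: by \<open>valid\<close>, a load on the way out departs before
  \<open>x\<close>, whereas all loads of \<open>X\<close> depart after \<open>x\<close>.\<close>

lemma act_step_retrieve:
  assumes v: "valid a P rw cl en ex" and f: "fits r c P rw cl en ex"
    and X: "X \<subseteq> P" "x \<in> P" "x \<notin> X" "\<And>z. z \<in> X \<Longrightarrow> x < z"
  shows "act_step r c (stored rw cl (insert x X)) (retrieve_act rw cl ex x) (stored rw cl X)"
proof -
  have nb: "nearby (ex x) (cl x)" and g: "rw x < r" "cl x < c" "ex x < c"
    using f X(2) by (auto simp: fits_def)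
  let ?p = "access_path (rw x) (ex x) (cl x)"
  have "set ?p \<inter> (\<lambda>x. (rw x, cl x)) ` X = {}"
  proof (rule ccontr)
    assume "set ?p \<inter> (\<lambda>x. (rw x, cl x)) ` X \<noteq> {}"
    then obtain z where z: "z \<in> X" "(rw z, cl z) \<in> set ?p"
      by blast
    have "z \<in> P" "x \<noteq> z"
      using X z by auto
    with v X(2) have "(rw x, cl x) \<noteq> (rw z, cl z)" "cl z = ex x \<and> rw z \<le> rw x \<longrightarrow> z < x"
      unfolding valid_def by blast+
    moreover have "x < z"
      using X z by auto
    ultimately show False
      using z(2) by (auto simp: set_access_path)
  qed
  then have "free_path r c (ran (stored rw cl X)) ?p"
    using g by (intro free_access_path nb) (auto simp: ran_stored set_access_path grid_def)
  then have fr: "free_path r c (ran (stored rw cl X)) (rev ?p)"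
    by (rule free_path_rev)
  have u: "(stored rw cl (insert x X))(x := None) = stored rw cl X"
    using X by (auto simp: stored_def)
  have "stored rw cl (insert x X) x = Some (hd (rev ?p))"
    by (simp add: stored_def hd_rev last_access_path)
  with act_step.retrieve[of "stored rw cl (insert x X)" x "rev ?p" r c] fr show ?thesis
    unfolding retrieve_act_def trace_out[OF nb] u
    by (simp add: hd_access_path last_rev access_path_nonempty front_def)
qed

lemma executes_stores:
  assumes v: "valid a (set A) rw cl en ex" and f: "fits r c (set A) rw cl en ex"
    and "distinct A" and a: "\<And>i. i < length A \<Longrightarrow> a (A ! i) = i"
  shows "A = zs @ ys \<Longrightarrow>
    executes r c (stored rw cl (set zs)) (map (store_act rw cl en) ys) (stored rw cl (set A))"
proof (induction ys arbitrary: zs)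
  case Nil
  then show ?case by (auto intro: executes.intros)
next
  case (Cons y ys)
  have "a z < a y" if z: "z \<in> set zs" for z
  proof -
    obtain i where i: "i < length zs" "z = zs ! i"
      using z by (auto simp: in_set_conv_nth)
    have "a z = i"
      using a[of i] i Cons.prems by (simp add: nth_append)
    moreover have "a y = length zs"
      using a[of "length zs"] Cons.prems by simp
    ultimately show ?thesis
      using i by simp
  qed
  then have "act_step r c (stored rw cl (set zs)) (store_act rw cl en y)
      (stored rw cl (insert y (set zs)))"
    using Cons.prems \<open>distinct A\<close> by (intro act_step_store[OF v f]) auto
  moreover have "executes r c (stored rw cl (set (zs @ [y]))) (map (store_act rw cl en) ys)
      (stored rw cl (set A))"
    using Cons.prems by (intro Cons.IH) simp
  ultimately show ?case
    by (auto intro: executes.intros)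
qed

lemma executes_retrieves:
  assumes v: "valid a {1..n} rw cl en ex" and f: "fits r c {1..n} rw cl en ex"
  shows "1 \<le> k \<Longrightarrow> k \<le> Suc n \<Longrightarrow>
    executes r c (stored rw cl {k..n}) (map (retrieve_act rw cl ex) [k..<Suc n]) Map.empty"
proof (induction "Suc n - k" arbitrary: k)
  case 0
  then have "k = Suc n" by simp
  then show ?case
    using executes.intros(1) by (auto simp: stored_def)
next
  case (Suc m)
  then have k: "k \<le> n" by simp
  have "act_step r c (stored rw cl (insert k {Suc k..n})) (retrieve_act rw cl ex k)
      (stored rw cl {Suc k..n})"
    using Suc k by (intro act_step_retrieve[OF v f]) auto
  moreover have "insert k {Suc k..n} = {k..n}"
    using k by auto
  moreover have "executes r c (stored rw cl {Suc k..n})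
      (map (retrieve_act rw cl ex) [Suc k..<Suc n]) Map.empty"
    using Suc k by (intro Suc.hyps) auto
  moreover have "[k..<Suc n] = k # [Suc k..<Suc n]"
    using k by (simp add: upt_conv_Cons del: upt_Suc)
  ultimately show ?case
    by (auto intro: executes.intros simp del: upt_Suc)
qed

lemma events_append: "events (as @ bs) = events as @ events bs"
  by (induction as rule: events.induct) auto

text \<open>This separates the geometry from the computation: a program only has to produce rows and
  columns that satisfy \<open>valid\<close> and \<open>fits\<close>.\<close>

theorem plan_of_valid:
  assumes v: "valid a {1..n} rw cl en ex" and f: "fits r c {1..n} rw cl en ex"
    and A: "distinct A" "set A = {1..n}" and a: "\<And>i. i < length A \<Longrightarrow> a (A ! i) = i"
    and p: "p = map (store_act rw cl en) A @ map (retrieve_act rw cl ex) [1..<Suc n]"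
  shows "serves r c A p \<and> without_relocations p \<and> column_adjacent_access p"
proof -
  have n: "length A = n"
    using distinct_card[OF A(1)] A(2) by simp
  have "executes r c (stored rw cl (set [])) (map (store_act rw cl en) A) (stored rw cl (set A))"
    using v f A a by (intro executes_stores[where a = a and ex = ex]) auto
  moreover have "executes r c (stored rw cl (set A)) (map (retrieve_act rw cl ex) [1..<Suc n])
      Map.empty"
    using executes_retrieves[OF v f, of 1] A(2) by simp
  moreover have "stored rw cl (set []) = Map.empty"
    by (simp add: stored_def)
  ultimately have "executes r c Map.empty p Map.empty"
    unfolding p by (metis executes_append)
  moreover have "events (map (store_act rw cl en) xs) = map Arrives xs" for xs
    by (induction xs) (auto simp: store_act_def)
  moreover have "events (map (retrieve_act rw cl ex) xs) = map Departs xs" for xs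
    by (induction xs) (auto simp: retrieve_act_def)
  moreover have "without_relocations p"
    unfolding p without_relocations_def by (auto simp: store_act_def retrieve_act_def)
  moreover have "column_adjacent_access p"
    unfolding column_adjacent_access_def
  proof (intro conjI allI impI)
    fix x u assume "Store x u \<in> set p"
    then have "x \<in> {1..n}" "u = trace [(0, en x), (rw x, en x), (rw x, cl x)]"
      using A(2) unfolding p by (auto simp: store_act_def retrieve_act_def)
    moreover have "nearby (en x) (cl x)"
      using f \<open>x \<in> {1..n}\<close> by (auto simp: fits_def)
    ultimately show "column_adjacent u"
      by (simp only: trace_in column_adjacent_access_path)
  next
    fix x u assume "Retrieve x u \<in> set p"
    then have "x \<in> {1..n}" "u = trace [(rw x, cl x), (rw x, ex x), (0, ex x)]"
      unfolding p by (auto simp: store_act_def retrieve_act_def)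
    moreover have "nearby (ex x) (cl x)"
      using f \<open>x \<in> {1..n}\<close> by (auto simp: fits_def)
    ultimately show "column_adjacent (rev u)"
      by (simp only: trace_out column_adjacent_access_path rev_rev_ident)
  qed
  ultimately show ?thesis
    unfolding serves_def using n by (simp add: p events_append)
qed

section \<open>Bottom-up merge sort\<close>

text \<open>Blocks of width \<open>w\<close> are the fibres of \<open>div w\<close>, so a shorter
  block at the end needs no special treatment. The inequality is strict because the keys are
  distinct labels.\<close>

definition runs :: "nat \<Rightarrow> nat \<Rightarrow> (nat \<Rightarrow> nat) \<Rightarrow> bool" where
  "runs w k X \<longleftrightarrow> (\<forall>u v. u < v \<and> v < k \<and> u div w = v div w \<longrightarrow> X u < X v)"

text \<open>The state between two merges. Contents are compared as sets only; for prefixes of equal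
  length and distinct keys this amounts to being a permutation.\<close>

definition merged :: "nat \<Rightarrow> nat \<Rightarrow> (nat \<Rightarrow> nat) \<Rightarrow> (nat \<Rightarrow> nat) \<Rightarrow> nat \<Rightarrow> bool" where
  "merged w m X Y k \<longleftrightarrow> (2 * w dvd k \<or> k = m) \<and> k \<le> m \<and> Y ` {..<k} = X ` {..<k} \<and> runs (2 * w) k Y"

text \<open>The state inside the merge of the blocks \<open>[b, d)\<close> and \<open>[d, e)\<close>
  of \<open>X\<close>, with heads \<open>i\<close> and \<open>j\<close> and next output position
  \<open>k\<close>. The equation \<open>i + j = k + d\<close> says that the output so far has as
  many entries as were consumed from both blocks.\<close>

definition merging :: "nat \<Rightarrow> nat \<Rightarrow> (nat \<Rightarrow> nat) \<Rightarrow> (nat \<Rightarrow> nat) \<Rightarrow> nat \<Rightarrow> nat \<Rightarrow> nat \<Rightarrow> nat \<Rightarrow> nat \<Rightarrow> nat \<Rightarrow> bool" where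
  "merging w m X Y b i d j e k \<longleftrightarrow>
     2 * w dvd b \<and> b \<le> k \<and> k \<le> e \<and> d = min (b + w) m \<and> e = min (b + 2 * w) m \<and>
     b \<le> i \<and> i \<le> d \<and> d \<le> j \<and> j \<le> e \<and> i + j = k + d \<and>
     Y ` {..<b} = X ` {..<b} \<and> runs (2 * w) k Y \<and>
     Y ` {b..<k} = X ` {b..<i} \<union> X ` {d..<j} \<and>
     (\<forall>t. b \<le> t \<and> t < k \<longrightarrow>
        (\<forall>u. i \<le> u \<and> u < d \<longrightarrow> Y t < X u) \<and> (\<forall>u. j \<le> u \<and> u < e \<longrightarrow> Y t < X u))"

lemma merging_init:
  assumes "merged w m X Y k" "k < m"
  shows "merging w m X Y k k (min (k + w) m) (min (k + w) m) (min (k + 2 * w) m) k"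
  using assms unfolding merged_def merging_def by auto

lemma merging_final:
  assumes "merging w m X Y b i d j e e"
  shows "merged w m X Y e"
proof -
  have ij: "i = d" "j = e" "b \<le> d" "d \<le> e" "e \<le> m"
    using assms unfolding merging_def by auto
  have split: "{..<e} = {..<b} \<union> {b..<e}" "{b..<e} = {b..<d} \<union> {d..<e}"
    using ij by auto
  have "Y ` {..<e} = X ` {..<e}"
    using assms ij unfolding merging_def split(1) image_Un by (subst (2) split(2)) (auto simp: image_Un)
  moreover have "2 * w dvd e \<or> e = m"
    using assms unfolding merging_def by (auto simp: min_def)
  ultimately show ?thesis
    using assms ij unfolding merged_def merging_def by auto
qed

lemma div_block:
  fixes b u v :: nat
  assumes "v dvd b" "b \<le> u" "u < b + v"
  shows "u div v = b div v"
proof -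
  obtain t where b: "b = v * t" using assms(1) by blast
  then have "u = v * t + (u - b)" "u - b < v"
    using assms by auto
  then have "u div v = t"
    by (metis add.commute add_cancel_right_right div_less div_mult_self2 gr_implies_not0)
  moreover have "b div v = t"
    using b \<open>u - b < v\<close> by auto
  ultimately show ?thesis by simp
qed

lemma runsD:
  assumes "runs w k X" "w dvd b" "b \<le> u" "u < v" "v < b + w" "v < k"
  shows "X u < X v"
  using assms div_block[of w b u] div_block[of w b v] unfolding runs_def by auto

text \<open>As \<open>b\<close> is a multiple of \<open>w\<close> and at most \<open>k\<close>, all
  positions in the block of \<open>k\<close> are at least \<open>b\<close>, and there the new entry
  exceeds everything.\<close>

lemma runs_Suc:
  assumes "runs w k Y" "w dvd b" "b \<le> k" "\<And>t. b \<le> t \<Longrightarrow> t < k \<Longrightarrow> Y t < x"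
  shows "runs w (Suc k) (Y(k := x))"
  unfolding runs_def
proof (intro allI impI, elim conjE)
  fix u v assume uv: "u < v" "v < Suc k" "u div w = v div w"
  show "(Y(k := x)) u < (Y(k := x)) v"
  proof (cases "v = k")
    case True
    have "b \<le> u"
    proof (rule ccontr)
      assume "\<not> b \<le> u"
      moreover obtain t where t: "b = w * t" using assms(2) by blast
      ultimately have "u < w * t" "w * t \<le> k" "0 < w"
        using assms(3) by (auto intro: gr0I)
      then have "u div w < t" "t \<le> k div w"
        by (auto simp: div_less_iff_less_mult less_eq_div_iff_mult_less_eq mult.commute)
      then show False using uv True by simp
    qed
    then show ?thesis using assms(4) uv True by simp
  next
    case False
    then show ?thesis using assms(1) uv unfolding runs_def by auto
  qed
qed

lemma merging_bounds:
  assumes "merging w m X Y b i d j e k" "runs w m X"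
  shows "\<And>u v. b \<le> u \<Longrightarrow> u < v \<Longrightarrow> v < d \<Longrightarrow> X u < X v"
    and "\<And>u v. d \<le> u \<Longrightarrow> u < v \<Longrightarrow> v < e \<Longrightarrow> X u < X v"
proof -
  have b: "2 * w dvd b" "w dvd b" "d = min (b + w) m" "e = min (b + 2 * w) m"
    using assms(1) unfolding merging_def by (auto dest: dvd_mult_left dvd_mult_right)
  show "X u < X v" if "b \<le> u" "u < v" "v < d" for u v
    using runsD[OF assms(2) b(2), of u v] that b by auto
  show "X u < X v" if "d \<le> u" "u < v" "v < e" for u v
    using runsD[OF assms(2), of "b + w" u v] that b by auto
qed

text \<open>The left head is below the rest of the right block because that block is sorted and
  \<open>X i \<le> X j\<close>; injectivity makes this strict. In the mirror case
  \<open>merging_right\<close> the comparison is strict from the start.\<close>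

lemma merging_left:
  assumes M: "merging w m X Y b i d j e k" and r: "runs w m X" and inj: "inj_on X {..<m}"
    and "k < e" "i < d" and le: "j < e \<Longrightarrow> X i \<le> X j"
  shows "merging w m X (Y(k := X i)) b (Suc i) d j e (Suc k)"
proof -
  have m: "2 * w dvd b" "b \<le> k" "d \<le> m" "e \<le> m" "b \<le> i" "i \<le> d" "d \<le> j" "j \<le> e" "i + j = k + d"
    using M unfolding merging_def by auto
  have low: "\<And>t u. b \<le> t \<Longrightarrow> t < k \<Longrightarrow> i \<le> u \<Longrightarrow> u < d \<Longrightarrow> Y t < X u"
      "\<And>t u. b \<le> t \<Longrightarrow> t < k \<Longrightarrow> j \<le> u \<Longrightarrow> u < e \<Longrightarrow> Y t < X u"
    using M unfolding merging_def by auto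
  have 1: "runs (2 * w) (Suc k) (Y(k := X i))"
    using M m low(1)[of _ i] \<open>i < d\<close> by (intro runs_Suc[where b = b]) (auto simp: merging_def)
  have "(Y(k := X i)) ` {b..<Suc k} = insert (X i) (Y ` {b..<k})"
    using m by (auto simp: image_def atLeastLessThanSuc)
  also have "\<dots> = X ` {b..<Suc i} \<union> X ` {d..<j}"
    using M m unfolding merging_def by (auto simp: atLeastLessThanSuc)
  finally have 2: "(Y(k := X i)) ` {b..<Suc k} = X ` {b..<Suc i} \<union> X ` {d..<j}" .
  have 3: "(Y(k := X i)) ` {..<b} = X ` {..<b}"
    using M m unfolding merging_def by auto
  have 4: "X i < X u" if "Suc i \<le> u" "u < d" for u
    using merging_bounds(1)[OF M r, of i u] that m by auto
  have 5: "X i < X u" if "j \<le> u" "u < e" for u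
  proof -
    have "X i \<noteq> X u"
      using inj_onD[OF inj, of i u] that m \<open>i < d\<close> by auto
    moreover have "X i \<le> X u"
      using le merging_bounds(2)[OF M r, of j u] that m by (cases "u = j") auto
    ultimately show ?thesis by simp
  qed
  show ?thesis
    unfolding merging_def
    using M 1 2 3 4 5 low \<open>i < d\<close> \<open>k < e\<close> m unfolding merging_def by (auto simp: less_Suc_eq)
qed

lemma merging_right:
  assumes M: "merging w m X Y b i d j e k" and r: "runs w m X" and inj: "inj_on X {..<m}"
    and "k < e" "j < e" and le: "i < d \<Longrightarrow> X j < X i"
  shows "merging w m X (Y(k := X j)) b i d (Suc j) e (Suc k)"
proof -
  have m: "2 * w dvd b" "b \<le> k" "d \<le> m" "e \<le> m" "b \<le> i" "i \<le> d" "d \<le> j" "j \<le> e" "i + j = k + d"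
    using M unfolding merging_def by auto
  have low: "\<And>t u. b \<le> t \<Longrightarrow> t < k \<Longrightarrow> i \<le> u \<Longrightarrow> u < d \<Longrightarrow> Y t < X u"
      "\<And>t u. b \<le> t \<Longrightarrow> t < k \<Longrightarrow> j \<le> u \<Longrightarrow> u < e \<Longrightarrow> Y t < X u"
    using M unfolding merging_def by auto
  have 1: "runs (2 * w) (Suc k) (Y(k := X j))"
    using M m low(2)[of _ j] \<open>j < e\<close> by (intro runs_Suc[where b = b]) (auto simp: merging_def)
  have "(Y(k := X j)) ` {b..<Suc k} = insert (X j) (Y ` {b..<k})"
    using m by (auto simp: image_def atLeastLessThanSuc)
  also have "\<dots> = X ` {b..<i} \<union> X ` {d..<Suc j}"
    using M m unfolding merging_def by (auto simp: atLeastLessThanSuc)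
  finally have 2: "(Y(k := X j)) ` {b..<Suc k} = X ` {b..<i} \<union> X ` {d..<Suc j}" .
  have 3: "(Y(k := X j)) ` {..<b} = X ` {..<b}"
    using M m unfolding merging_def by auto
  have 4: "X j < X u" if "Suc j \<le> u" "u < e" for u
    using merging_bounds(2)[OF M r, of j u] that m by auto
  have 5: "X j < X u" if "i \<le> u" "u < d" for u
    using le merging_bounds(1)[OF M r, of i u] that m by (cases "u = i") auto
  show ?thesis
    unfolding merging_def
    using M 1 2 3 4 5 low \<open>j < e\<close> \<open>k < e\<close> m unfolding merging_def by (auto simp: less_Suc_eq)
qed

section \<open>The sorting program and its running time\<close>

definition merge_setup :: com where
  "merge_setup =
     ''i'' ::= Var ''k'' ;;
     ''d'' ::= Add (Var ''k'') (Var ''w'') ;;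
     If (Less (Var ''m'') (Var ''d'')) (''d'' ::= Var ''m'') Skip ;;
     ''j'' ::= Var ''d'' ;;
     ''e'' ::= Add (Var ''d'') (Var ''w'') ;;
     If (Less (Var ''m'') (Var ''e'')) (''e'' ::= Var ''m'') Skip"

definition merge_move :: com where
  "merge_move =
     If (Conj (Less (Var ''i'') (Var ''d''))
          (Neg (Conj (Less (Var ''j'') (Var ''e''))
                     (Less (Arr ''key'' (Var ''j'')) (Arr ''key'' (Var ''i''))))))
       (AssignArr ''tmp'' (Var ''k'') (Arr ''key'' (Var ''i'')) ;; ''i'' ::= Add (Var ''i'') (Num 1))
       (AssignArr ''tmp'' (Var ''k'') (Arr ''key'' (Var ''j'')) ;; ''j'' ::= Add (Var ''j'') (Num 1))"

text \<open>A new pair of blocks is set up whenever the output reaches the end \<open>e\<close> of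
  the previous pair. A pass thereby becomes one flat loop with constant cost per iteration instead
  of a nested one.\<close>

definition merge_body :: com where
  "merge_body = (If (Eq (Var ''k'') (Var ''e'')) merge_setup Skip ;; merge_move)"

text \<open>The value \<open>e = 0\<close> makes the very first iteration set up a pair.\<close>

definition merge_pass :: com where
  "merge_pass =
     ''e'' ::= Num 0 ;;
     loop ''k'' merge_body ;;
     loop ''k'' (AssignArr ''key'' (Var ''k'') (Arr ''tmp'' (Var ''k''))) ;;
     ''w'' ::= Add (Var ''w'') (Var ''w'')"

definition merge_sort :: com where
  "merge_sort = (''w'' ::= Num 1 ;; While (Less (Var ''w'') (Var ''m'')) merge_pass)"

lemma mods_loop:
  "mvars (loop i C) = insert i (mvars C)" "marrs (loop i C) = marrs C"
  "reads (loop i C) = reads C" "acts (loop i C) = acts C"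
  by (auto simp: loop_def)

lemma mods_merge_body:
  "mvars merge_body = {''i'', ''d'', ''j'', ''e''}" "marrs merge_body = {''tmp''}"
  "\<not> reads merge_body" "\<not> acts merge_body"
  by (auto simp: merge_body_def merge_setup_def merge_move_def)

lemma mods_merge_pass:
  "mvars merge_pass = {''i'', ''d'', ''j'', ''e'', ''k'', ''w''}"
  "marrs merge_pass = {''tmp'', ''key''}" "\<not> reads merge_pass" "\<not> acts merge_pass"
  by (auto simp: merge_pass_def mods_loop mods_merge_body)

lemma mods_merge_sort:
  "mvars merge_sort = {''i'', ''d'', ''j'', ''e'', ''k'', ''w''}"
  "marrs merge_sort = {''tmp'', ''key''}" "\<not> reads merge_sort" "\<not> acts merge_sort"
  by (auto simp: merge_sort_def mods_merge_pass)

abbreviation merge_inv :: "nat \<Rightarrow> nat \<Rightarrow> (nat \<Rightarrow> nat) \<Rightarrow> nat \<Rightarrow> mstate \<Rightarrow> nat \<Rightarrow> bool" where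
  "merge_inv w m X b s \<equiv>
     merging w m X (arr s ''tmp'') b (scal s ''i'') (scal s ''d'') (scal s ''j'') (scal s ''e'')"

text \<open>The bounds of the current pair matter only while \<open>k < e\<close>; at
  \<open>k = e\<close> the next iteration recomputes them.\<close>

definition pass_inv :: "nat \<Rightarrow> nat \<Rightarrow> (nat \<Rightarrow> nat) \<Rightarrow> nat \<Rightarrow> mstate \<Rightarrow> bool" where
  "pass_inv w m X k s \<longleftrightarrow> arr s ''key'' = X \<and>
     (k = scal s ''e'' \<and> merged w m X (arr s ''tmp'') k \<or>
      k < scal s ''e'' \<and> (\<exists>b. merge_inv w m X b s k))"

lemma wp_merge_move:
  assumes M: "merge_inv w m X b s k" and k: "k < scal s ''e''" "scal s ''k'' = k"
    and X: "arr s ''key'' = X" "runs w m X" "inj_on X {..<m}" "\<And>u. u < m \<Longrightarrow> X u < B" "m < B"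
  shows "wp l A B merge_move (\<lambda>t s'. t \<le> 30 \<and> pass_inv w m X (Suc k) s') s"
proof -
  have e: "scal s ''i'' \<le> scal s ''d''" "scal s ''d'' \<le> scal s ''j''" "scal s ''j'' \<le> scal s ''e''"
    "scal s ''e'' \<le> m" "scal s ''i'' + scal s ''j'' = k + scal s ''d''"
    using M unfolding merging_def by auto
  have fin: "pass_inv w m X (Suc k) s'"
    if "merge_inv w m X b s' (Suc k)" "arr s' ''key'' = X" "scal s' ''e'' = scal s ''e''" for s'
    using that k merging_final[of w m X "arr s' ''tmp''" b] unfolding pass_inv_def
    by (cases "Suc k = scal s ''e''") auto
  show ?thesis
  proof (cases "scal s ''i'' < scal s ''d'' \<and>
      \<not> (scal s ''j'' < scal s ''e'' \<and> X (scal s ''j'') < X (scal s ''i''))")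
    case True
    then have b: "bval (Conj (Less (Var ''i'') (Var ''d''))
          (Neg (Conj (Less (Var ''j'') (Var ''e''))
                     (Less (Arr ''key'' (Var ''j'')) (Arr ''key'' (Var ''i'')))))) s"
      using X by simp
    have "merging w m X ((arr s ''tmp'')(k := X (scal s ''i''))) b (Suc (scal s ''i'')) (scal s ''d'')
        (scal s ''j'') (scal s ''e'') (Suc k)"
      using True by (intro merging_left[OF M X(2,3) k(1)]) auto
    moreover have "X (scal s ''i'') < B" "Suc (scal s ''i'') < B" "k < B"
      using e True X(4)[of "scal s ''i''"] X(5) k by auto
    moreover from calculation(1) have "pass_inv w m X (Suc k)
        (s\<lparr>arr := (arr s)(''tmp'' := (arr s ''tmp'')(k := X (scal s ''i''))),
          scal := (scal s)(''i'' := Suc (scal s ''i''))\<rparr>)"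
      using X(1) by (intro fin) auto
    ultimately show ?thesis
      unfolding merge_move_def wp_simps using b k X(1) by simp
  next
    case False
    then have b: "\<not> bval (Conj (Less (Var ''i'') (Var ''d''))
          (Neg (Conj (Less (Var ''j'') (Var ''e''))
                     (Less (Arr ''key'' (Var ''j'')) (Arr ''key'' (Var ''i'')))))) s"
      using X by simp
    have j: "scal s ''j'' < scal s ''e''"
      using False e k by auto
    have "merging w m X ((arr s ''tmp'')(k := X (scal s ''j''))) b (scal s ''i'') (scal s ''d'')
        (Suc (scal s ''j'')) (scal s ''e'') (Suc k)"
      using False j by (intro merging_right[OF M X(2,3) k(1)]) auto
    moreover have "X (scal s ''j'') < B" "Suc (scal s ''j'') < B" "k < B"
      using e j X(4)[of "scal s ''j''"] X(5) k by auto
    moreover from calculation(1) have "pass_inv w m X (Suc k)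
        (s\<lparr>arr := (arr s)(''tmp'' := (arr s ''tmp'')(k := X (scal s ''j''))),
          scal := (scal s)(''j'' := Suc (scal s ''j''))\<rparr>)"
      using X(1) by (intro fin) auto
    ultimately show ?thesis
      unfolding merge_move_def wp_simps using b k X(1) by auto
  qed
qed

lemma wp_merge_body:
  assumes P: "pass_inv w m X k s" and k: "k < m" "scal s ''k'' = k" "scal s ''m'' = m"
    and w: "scal s ''w'' = w" "0 < w" "w < m"
    and X: "runs w m X" "inj_on X {..<m}" "\<And>u. u < m \<Longrightarrow> X u < B" "3 * m < B"
  shows "wp l A B merge_body (\<lambda>t s'. t \<le> 70 \<and> pass_inv w m X (Suc k) s') s"
proof (cases "k = scal s ''e''")
  case True
  then have "merged w m X (arr s ''tmp'') k" and K: "arr s ''key'' = X"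
    using P unfolding pass_inv_def by auto
  then have M: "merging w m X (arr s ''tmp'') k k (min (k + w) m) (min (k + w) m) (min (k + 2 * w) m) k"
    using k by (intro merging_init) auto
  let ?Q = "\<lambda>s'. merge_inv w m X k s' k \<and> k < scal s' ''e'' \<and> scal s' ''k'' = k \<and> arr s' ''key'' = X"
  have "wp l A B merge_setup (\<lambda>t s'. t \<le> 30 \<and> ?Q s') s"
    unfolding merge_setup_def wp_simps
    using M K w k X(4) by (auto simp: min_def mult_2 add.assoc split: if_splits)
  then have 1: "wp l A B merge_setup (\<lambda>t1 s1. wp l A B merge_move
      (\<lambda>t s'. 1 + bcost (Eq (Var ''k'') (Var ''e'')) + t1 + t \<le> 70 \<and> pass_inv w m X (Suc k) s') s1) s"
  proof (rule wp_conseq)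
    fix t1 :: nat and s1 assume a: "t1 \<le> 30 \<and> ?Q s1"
    have "wp l A B merge_move (\<lambda>t s'. t \<le> 30 \<and> pass_inv w m X (Suc k) s') s1"
      using a X by (intro wp_merge_move[where b = k]) auto
    then show "wp l A B merge_move (\<lambda>t s'. 1 + bcost (Eq (Var ''k'') (Var ''e'')) + t1 + t \<le> 70 \<and>
        pass_inv w m X (Suc k) s') s1"
      by (rule wp_conseq) (use a in auto)
  qed
  show ?thesis
    unfolding merge_body_def wp_simps(4,5) using 1 True k by simp
next
  case False
  then obtain b where "merge_inv w m X b s k" "k < scal s ''e''" "arr s ''key'' = X"
    using P unfolding pass_inv_def by auto
  then have "wp l A B merge_move (\<lambda>t s'. t \<le> 30 \<and> pass_inv w m X (Suc k) s') s"
    using k X by (intro wp_merge_move) auto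
  then have "wp l A B merge_move (\<lambda>t s'. 1 + bcost (Eq (Var ''k'') (Var ''e'')) + 1 + t \<le> 70 \<and>
      pass_inv w m X (Suc k) s') s"
    by (rule wp_conseq) auto
  then show ?thesis
    unfolding merge_body_def wp_simps using False k by simp
qed

lemma wp_merge_pass:
  assumes X: "arr s ''key'' = X" "runs w m X" "inj_on X {..<m}" "\<And>u. u < m \<Longrightarrow> X u < B" "3 * m < B"
    and w: "scal s ''m'' = m" "scal s ''w'' = w" "0 < w" "w < m"
  shows "wp l A B merge_pass (\<lambda>t s'. t \<le> 120 * (m + 1) \<and>
      runs (2 * w) m (arr s' ''key'') \<and> arr s' ''key'' ` {..<m} = X ` {..<m} \<and>
      scal s' ''w'' = 2 * w) s"
proof -
  let ?s0 = "s\<lparr>scal := (scal s)(''e'' := 0)\<rparr>"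
  let ?L = "loop ''k'' merge_body"
  let ?L2 = "loop ''k'' (AssignArr ''key'' (Var ''k'') (Arr ''tmp'' (Var ''k'')))"
  have 1: "wp l A B ?L (\<lambda>t s'. t \<le> (70 + 8) * (scal ?s0 ''m'' + 1) \<and>
      pass_inv w m X (scal ?s0 ''m'') s' \<and> same ?L ?s0 s') ?s0"
  proof (rule wp_loop)
    show "pass_inv w m X 0 ?s0"
      using X by (auto simp: pass_inv_def merged_def runs_def)
    show "scal ?s0 ''m'' < B" using w X by simp
    show "''k'' \<noteq> ''m''" "''m'' \<notin> mvars merge_body" "''k'' \<notin> mvars merge_body"
      by (auto simp: mods_merge_body)
    show "pass_inv w m X k (s\<lparr>scal := (scal s)(''k'' := v)\<rparr>)" if "pass_inv w m X k s" for k v s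
      using that by (auto simp: pass_inv_def)
    show "wp l A B merge_body (\<lambda>t s'. t \<le> 70 \<and> pass_inv w m X (Suc k) s') s1"
      if "pass_inv w m X k s1" "same ?L ?s0 s1" "scal s1 ''k'' = k" "k < scal ?s0 ''m''" for k s1
      using that w X
      by (intro wp_merge_body) (auto simp: same_def mods_loop mods_merge_body)
  qed
  define J where "J Y k s' \<longleftrightarrow> arr s' ''tmp'' = Y \<and> (\<forall>u<k. arr s' ''key'' u = Y u)"
    for Y :: "nat \<Rightarrow> nat" and k and s' :: mstate
  have 2: "wp l A B ?L2 (\<lambda>t s'. t \<le> (10 + 8) * (scal s1 ''m'' + 1) \<and>
      J (arr s1 ''tmp'') (scal s1 ''m'') s' \<and> same ?L2 s1 s') s1"
    if t: "scal s1 ''m'' = m" "\<And>u. u < m \<Longrightarrow> arr s1 ''tmp'' u < B" for s1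
  proof (rule wp_loop)
    show "J (arr s1 ''tmp'') 0 s1" by (simp add: J_def)
    show "scal s1 ''m'' < B" using t X by simp
    show "J (arr s1 ''tmp'') k (s\<lparr>scal := (scal s)(''k'' := v)\<rparr>)" if "J (arr s1 ''tmp'') k s" for k v s
      using that by (auto simp: J_def)
    show "wp l A B (AssignArr ''key'' (Var ''k'') (Arr ''tmp'' (Var ''k'')))
        (\<lambda>t s'. t \<le> 10 \<and> J (arr s1 ''tmp'') (Suc k) s') s2"
      if "J (arr s1 ''tmp'') k s2" "scal s2 ''k'' = k" "k < scal s1 ''m''" for k s2
      using that t X(5) unfolding wp_simps by (auto simp: J_def less_Suc_eq)
  qed auto
  have 3: "wp l A B (?L2 ;; ''w'' ::= Add (Var ''w'') (Var ''w''))
      (\<lambda>t s'. t \<le> 30 * (m + 1) \<and> runs (2 * w) m (arr s' ''key'') \<and>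
        arr s' ''key'' ` {..<m} = X ` {..<m} \<and> scal s' ''w'' = 2 * w) s1"
    if "pass_inv w m X m s1" "scal s1 ''m'' = m" "scal s1 ''w'' = w" for s1
  proof -
    let ?Y = "arr s1 ''tmp''"
    \<comment> \<open>The other alternative of \<open>pass_inv\<close> would need
      \<open>m < e\<close>, but a pair never ends beyond \<open>m\<close>.\<close>
    have "merged w m X ?Y m"
      using that(1) unfolding pass_inv_def merging_def by auto
    then have Y: "runs (2 * w) m ?Y" "?Y ` {..<m} = X ` {..<m}"
      unfolding merged_def by auto
    have "?Y u < B" if "u < m" for u
    proof -
      have "?Y u \<in> X ` {..<m}" using Y(2) that by blast
      then show ?thesis using X(4) by auto
    qed
    then have "wp l A B ?L2 (\<lambda>t s'. t \<le> (10 + 8) * (scal s1 ''m'' + 1) \<and>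
      J (arr s1 ''tmp'') (scal s1 ''m'') s' \<and> same ?L2 s1 s') s1"
      using that by (intro 2) auto
    then show ?thesis
      unfolding wp_simps
    proof (rule wp_conseq, goal_cases)
      case (1 t s')
      then have e: "\<And>u. u < m \<Longrightarrow> arr s' ''key'' u = ?Y u" "scal s' ''w'' = w"
        using that by (auto simp: J_def same_def mods_loop)
      then have "runs (2 * w) m (arr s' ''key'')"
        using Y(1) unfolding runs_def by auto
      moreover have "arr s' ''key'' ` {..<m} = X ` {..<m}"
        unfolding Y(2)[symmetric] using e by (intro image_cong) auto
      ultimately show ?case
        using 1 that e w X(5) by auto
    qed
  qed
  show ?thesis
    unfolding merge_pass_def wp_simps(2) wp_simps(4)[of _ _ _ "''e'' ::= _"]
  proof (intro conjI)
    show "aval (Num 0) s < B" using X w by simp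
    have "wp l A B (?L ;; (?L2 ;; ''w'' ::= Add (Var ''w'') (Var ''w'')))
        (\<lambda>t s'. t \<le> 110 * (m + 1) \<and> runs (2 * w) m (arr s' ''key'') \<and>
        arr s' ''key'' ` {..<m} = X ` {..<m} \<and> scal s' ''w'' = 2 * w) ?s0"
      unfolding wp_simps(4)[of _ _ _ ?L]
    proof (rule wp_conseq[OF 1])
      fix t :: nat and s1
      assume a: "t \<le> (70 + 8) * (scal ?s0 ''m'' + 1) \<and> pass_inv w m X (scal ?s0 ''m'') s1 \<and> same ?L ?s0 s1"
      show "wp l A B (?L2 ;; ''w'' ::= Add (Var ''w'') (Var ''w'')) (\<lambda>t2 s'. t + t2 \<le> 110 * (m + 1) \<and>
        runs (2 * w) m (arr s' ''key'') \<and> arr s' ''key'' ` {..<m} = X ` {..<m} \<and> scal s' ''w'' = 2 * w) s1"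
        by (rule wp_conseq[OF 3]) (use a w in \<open>auto simp: same_def mods_loop mods_merge_body\<close>)
    qed
    then show "wp l A B (?L ;; (?L2 ;; ''w'' ::= Add (Var ''w'') (Var ''w'')))
     (\<lambda>t2 s2. 1 + acost (Num 0) + t2 \<le> 120 * (m + 1) \<and> runs (2 * w) m (arr s2 ''key'') \<and>
       arr s2 ''key'' ` {..<m} = X ` {..<m} \<and> scal s2 ''w'' = 2 * w)
      (s\<lparr>scal := (scal s)(''e'' := aval (Num 0) s)\<rparr>)"
      by (auto elim!: wp_conseq)
  qed
qed

theorem wp_merge_sort:
  assumes X: "arr s ''key'' = X" "inj_on X {..<m}" "\<And>u. u < m \<Longrightarrow> X u < B" "3 * m + 1 < B"
    and m: "scal s ''m'' = m" "m \<le> 2 ^ L"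
  shows "wp l A B merge_sort (\<lambda>t s'. t \<le> 140 * ((L + 1) * (m + 1)) \<and>
      (\<forall>u v. u < v \<and> v < m \<longrightarrow> arr s' ''key'' u < arr s' ''key'' v) \<and>
      arr s' ''key'' ` {..<m} = X ` {..<m}) s"
proof -
  let ?s0 = "s\<lparr>scal := (scal s)(''w'' := 1)\<rparr>"
  \<comment> \<open>The width is always a power of two and its exponent measures progress;
    \<open>m \<le> 2 ^ L\<close> limits the number of passes to \<open>L\<close>.\<close>
  define lg where "lg w = (THE p. w = 2 ^ p)" for w :: nat
  have lg: "lg (2 ^ p) = p" for p
    unfolding lg_def by auto
  define I where "I s' \<longleftrightarrow> runs (scal s' ''w'') m (arr s' ''key'') \<and>
      arr s' ''key'' ` {..<m} = X ` {..<m} \<and> (\<exists>p. scal s' ''w'' = 2 ^ p)" for s' :: mstate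
  have 1: "wp l A B (While (Less (Var ''w'') (Var ''m'')) merge_pass)
     (\<lambda>t s'. t \<le> (L - lg (scal ?s0 ''w'')) * (1 + bcost (Less (Var ''w'') (Var ''m'')) + 120 * (m + 1)) +
       (1 + bcost (Less (Var ''w'') (Var ''m''))) \<and>
      I s' \<and> \<not> bval (Less (Var ''w'') (Var ''m'')) s' \<and> same merge_pass ?s0 s') ?s0"
  proof (rule wp_while[where I = I and \<Phi> = "\<lambda>s. L - lg (scal s ''w'')"])
    show "I ?s0"
      using X by (auto simp: I_def runs_def intro: exI[of _ 0])
  next
    fix s1 assume a: "I s1" "same merge_pass ?s0 s1" "bval (Less (Var ''w'') (Var ''m'')) s1"
    obtain p where p: "scal s1 ''w'' = 2 ^ p" using a(1) unfolding I_def by auto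
    have m1: "scal s1 ''m'' = m" using a(2) m by (auto simp: same_def mods_merge_pass)
    have lt: "2 ^ p < m" using a(3) p m1 by simp
    have "(2::nat) ^ p < 2 ^ L" using lt m(2) by linarith
    then have pL: "p < L" by (rule power_less_imp_less_exp[rotated]) simp
    let ?Y = "arr s1 ''key''"
    have Y: "?Y ` {..<m} = X ` {..<m}" "runs (2 ^ p) m ?Y" using a(1) p unfolding I_def by auto
    \<comment> \<open>Distinctness of the keys survives a pass because the image still has
      \<open>m\<close> elements.\<close>
    have "inj_on ?Y {..<m}"
      using Y(1) X(2) by (intro eq_card_imp_inj_on) (auto simp: card_image)
    moreover have "?Y u < B" if "u < m" for u
    proof -
      have "?Y u \<in> X ` {..<m}" using Y(1) that by blast
      then show ?thesis using X(3) by auto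
    qed
    ultimately have "wp l A B merge_pass (\<lambda>t s'. t \<le> 120 * (m + 1) \<and>
      runs (2 * 2 ^ p) m (arr s' ''key'') \<and> arr s' ''key'' ` {..<m} = ?Y ` {..<m} \<and>
      scal s' ''w'' = 2 * 2 ^ p) s1"
      using X Y m1 p lt by (intro wp_merge_pass) auto
    then show "wp l A B merge_pass (\<lambda>t s'. t \<le> 120 * (m + 1) \<and> I s' \<and>
        L - lg (scal s' ''w'') < L - lg (scal s1 ''w'')) s1"
    proof (rule wp_conseq, goal_cases)
      case (1 t s')
      then have "scal s' ''w'' = 2 ^ Suc p" by simp
      then show ?case
        using 1 Y pL p lg[of "Suc p"] lg[of p] unfolding I_def by (auto simp del: power_Suc)
    qed
  qed
  have e: "lg (Suc 0) = 0" using lg[of 0] by simp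
  show ?thesis
    unfolding merge_sort_def wp_simps
  proof (intro conjI)
    show "aval (Num 1) s < B" using X by simp
    show "wp l A B (While (Less (Var ''w'') (Var ''m'')) merge_pass)
     (\<lambda>t2 s2. 1 + acost (Num 1) + t2 \<le> 140 * ((L + 1) * (m + 1)) \<and>
       (\<forall>u v. u < v \<and> v < m \<longrightarrow> arr s2 ''key'' u < arr s2 ''key'' v) \<and>
       arr s2 ''key'' ` {..<m} = X ` {..<m})
      (s\<lparr>scal := (scal s)(''w'' := aval (Num 1) s)\<rparr>)"
      unfolding aval.simps
    proof (rule wp_conseq[OF 1], goal_cases)
      case (1 t s')
      then have "scal s' ''m'' = m" using m by (auto simp: same_def mods_merge_pass)
      then have w: "m \<le> scal s' ''w''" using 1 by simp
      have r: "runs (scal s' ''w'') m (arr s' ''key'')" using 1 unfolding I_def by simp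
      have "arr s' ''key'' u < arr s' ''key'' v" if "u < v" "v < m" for u v
        using r w that unfolding runs_def by auto
      moreover have "t \<le> L * (124 + 120 * m) + 4"
        using 1 e by (simp add: algebra_simps)
      then have "2 + t \<le> 140 * ((L + 1) * (m + 1))"
        by (simp add: algebra_simps)
      ultimately show ?case
        using 1 unfolding I_def by auto
    qed
  qed
qed

section \<open>Placement in three columns\<close>

text \<open>The new load meets every older one in two roles: its own paths through \<open>e\<close>
  and \<open>f\<close> must be free, and its cell \<open>(i, k)\<close> must not obstruct older
  loads that use column \<open>k\<close>.\<close>

lemma valid_insert:
  assumes "valid a P rw cl en ex" "w \<notin> P"
    and "\<And>z. z \<in> P \<Longrightarrow> cl z = k \<Longrightarrow> rw z \<noteq> i"
    and "\<And>z. z \<in> P \<Longrightarrow> cl z = e \<Longrightarrow> rw z \<le> i \<Longrightarrow> a w < a z"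
    and "\<And>z. z \<in> P \<Longrightarrow> cl z = f \<Longrightarrow> rw z \<le> i \<Longrightarrow> z < w"
    and "\<And>z. z \<in> P \<Longrightarrow> en z = k \<Longrightarrow> i \<le> rw z \<Longrightarrow> a z < a w"
    and "\<And>z. z \<in> P \<Longrightarrow> ex z = k \<Longrightarrow> i \<le> rw z \<Longrightarrow> w < z"
  shows "valid a (insert w P) (rw(w := i)) (cl(w := k)) (en(w := e)) (ex(w := f))"
proof -
  have ne: "z \<noteq> w" if "z \<in> P" for z using that assms(2) by auto
  have "(rw z, cl z) \<noteq> (i, k) \<and> (k = en z \<and> i \<le> rw z \<longrightarrow> a z < a w) \<and>
      (k = ex z \<and> i \<le> rw z \<longrightarrow> w < z)" if "z \<in> P" for z
    using assms(3,6,7)[OF that] by auto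
  moreover have "(i, k) \<noteq> (rw z, cl z) \<and> (cl z = e \<and> rw z \<le> i \<longrightarrow> a w < a z) \<and>
      (cl z = f \<and> rw z \<le> i \<longrightarrow> z < w)" if "z \<in> P" for z
    using assms(3,4,5)[OF that] by auto
  ultimately show ?thesis
    using assms(1) ne unfolding valid_def by (simp add: ball_simps)
qed

text \<open>The last loads go to the columns \<open>q\<close>, \<open>q + 1\<close> and \<open>q + 2\<close>, which are filled from the front
  up to the rows \<open>f\<close>, \<open>g\<close> and \<open>p\<close>. \<open>P0\<close> contains the loads in the columns to the left of them,
  \<open>P\<close> those that were assigned a cell in one of the three columns, and \<open>U\<close> the remaining ones.\<close>

definition shape :: "nat \<Rightarrow> nat \<Rightarrow> (nat \<Rightarrow> nat) \<Rightarrow> nat set \<Rightarrow> nat \<Rightarrow> nat \<Rightarrow> nat \<Rightarrow>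
    nat \<Rightarrow> nat \<Rightarrow> nat \<Rightarrow> nat \<Rightarrow> nat \<Rightarrow> bool" where
  "shape h q a U f g p z i k e x \<longleftrightarrow>
     k = q \<and> e = q + 1 \<and> x = q \<and> i < f \<and> (\<forall>w\<in>U. z < w) \<or>
     k = q + 1 \<and> e = q + 1 \<and> i < g \<and> (\<forall>w\<in>U. a w < a z) \<and>
       (x = q \<and> i < f \<or> x = q + 2 \<and> p = h) \<or>
     k = q + 2 \<and> x = q + 2 \<and> i < p \<and> (\<forall>w\<in>U. z < w) \<and>
       (e = q + 2 \<and> (\<forall>w\<in>U. a w < a z) \<or> e = q + 1 \<and> f = h \<and> g = h)"

text \<open>The unassigned loads \<open>U\<close> occur only in comparisons with all of their
  members, so the invariant says of each assigned load what any later insertion may need. If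
  \<open>M\<close> lags behind \<open>L\<close>, then by one cell: the load of \<open>L\<close> in
  row \<open>g\<close> enters across this cell, so its future occupant must arrive later, and
  \<open>y\<close> shows that such a load is available. Loads of \<open>P0\<close> may enter through
  column \<open>q\<close>, which is harmless as they arrive before all of \<open>U\<close>.\<close>

definition three :: "nat \<Rightarrow> nat \<Rightarrow> (nat \<Rightarrow> nat) \<Rightarrow> nat set \<Rightarrow> nat set \<Rightarrow> nat set \<Rightarrow>
    (nat \<Rightarrow> nat) \<Rightarrow> (nat \<Rightarrow> nat) \<Rightarrow> (nat \<Rightarrow> nat) \<Rightarrow> (nat \<Rightarrow> nat) \<Rightarrow> nat \<Rightarrow> nat \<Rightarrow> nat \<Rightarrow> bool" where
  "three h q a P0 P U rw cl en ex f g p \<longleftrightarrow>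
     f \<le> h \<and> g \<le> h \<and> p \<le> h \<and> f + g + p = card P \<and> finite P \<and> (P0 \<union> P) \<inter> U = {} \<and>
     (\<forall>z\<in>P0. cl z < q \<and> ex z < q \<and> en z \<le> q \<and> (\<forall>w\<in>U. a z < a w)) \<and>
     (\<forall>z\<in>P. shape h q a U f g p z (rw z) (cl z) (en z) (ex z)) \<and>
     (g < f \<longrightarrow> f = g + 1 \<and> (\<exists>y\<in>U. \<forall>z\<in>P. cl z = q \<and> rw z = g \<longrightarrow> a z < a y)) \<and>
     valid a (P0 \<union> P) rw cl en ex"

lemma three_leftD:
  assumes "three h q a P0 P U rw cl en ex f g p" "z \<in> P0"
  shows "cl z < q" "ex z < q" "en z \<le> q" "w \<in> U \<Longrightarrow> a z < a w"
  using assms unfolding three_def by auto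

lemma three_cases:
  assumes "three h q a P0 P U rw cl en ex f g p" "z \<in> P"
  obtains
    (left) "cl z = q" "en z = q + 1" "ex z = q" "rw z < f" "\<And>w. w \<in> U \<Longrightarrow> z < w"
  | (middle) "cl z = q + 1" "en z = q + 1" "ex z = q" "rw z < f" "rw z < g" "\<And>w. w \<in> U \<Longrightarrow> a w < a z"
  | (middle_right) "cl z = q + 1" "en z = q + 1" "ex z = q + 2" "rw z < g" "p = h" "\<And>w. w \<in> U \<Longrightarrow> a w < a z"
  | (right) "cl z = q + 2" "en z = q + 2" "ex z = q + 2" "rw z < p" "\<And>w. w \<in> U \<Longrightarrow> z < w"
      "\<And>w. w \<in> U \<Longrightarrow> a w < a z"
  | (right_middle) "cl z = q + 2" "en z = q + 1" "ex z = q + 2" "rw z < p" "\<And>w. w \<in> U \<Longrightarrow> z < w"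
      "f = h" "g = h"
proof -
  have "shape h q a U f g p z (rw z) (cl z) (en z) (ex z)"
    using assms unfolding three_def by auto
  then show thesis
    unfolding shape_def
    apply (elim disjE conjE)
    subgoal by (rule left) auto
    subgoal by (rule middle) auto
    subgoal by (rule middle_right) auto
    subgoal by (rule right) auto
    subgoal by (rule right_middle) auto
    done
qed

text \<open>The conditions on the fill levels are strict lower bounds or say that a column is full,
  and those on \<open>U\<close> are universal. Both kinds persist while columns grow up to
  \<open>h\<close> and \<open>U\<close> shrinks.\<close>

lemma shape_mono:
  assumes "shape h q a U f g p z i k e x" "f \<le> f'" "f' \<le> h" "g \<le> g'" "g' \<le> h" "p \<le> p'" "p' \<le> h"
    "U' \<subseteq> U"
  shows "shape h q a U' f' g' p' z i k e x"
  using assms unfolding shape_def by (elim disjE conjE) (simp_all add: subset_eq)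

text \<open>The common part of all placements: older loads keep their shape by
  \<open>shape_mono\<close>, which leaves the shape of the new load, the lag of \<open>M\<close> and
  \<open>valid\<close>.\<close>

lemma three_step:
  assumes T: "three h q a P0 P U rw cl en ex f g p" and w: "w \<in> U"
    and le: "f \<le> f'" "f' \<le> h" "g \<le> g'" "g' \<le> h" "p \<le> p'" "p' \<le> h" "f' + g' + p' = f + g + p + 1"
    and new: "shape h q a (U - {w}) f' g' p' w i k e x"
    and lag: "g' < f' \<Longrightarrow> f' = g' + 1 \<and>
      (\<exists>y\<in>U - {w}. \<forall>z\<in>insert w P. (cl(w := k)) z = q \<and> (rw(w := i)) z = g' \<longrightarrow> a z < a y)"
    and v: "valid a (P0 \<union> insert w P) (rw(w := i)) (cl(w := k)) (en(w := e)) (ex(w := x))"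
  shows "three h q a P0 (insert w P) (U - {w}) (rw(w := i)) (cl(w := k)) (en(w := e)) (ex(w := x)) f' g' p'"
proof -
  have "w \<notin> P" "w \<notin> P0" "finite P" using T w unfolding three_def by auto
  then have "card (insert w P) = card P + 1" by simp
  moreover have "shape h q a (U - {w}) f' g' p' z (rw z) (cl z) (en z) (ex z)" if "z \<in> P" for z
  proof -
    have "shape h q a U f g p z (rw z) (cl z) (en z) (ex z)"
      using T that unfolding three_def by auto
    from shape_mono[OF this le(1-6)] show ?thesis by blast
  qed
  then have "\<forall>z\<in>insert w P. shape h q a (U - {w}) f' g' p' z ((rw(w := i)) z) ((cl(w := k)) z)
      ((en(w := e)) z) ((ex(w := x)) z)"
    using new \<open>w \<notin> P\<close> by auto
  moreover have "\<forall>z\<in>P0. (cl(w := k)) z < q \<and> (ex(w := x)) z < q \<and> (en(w := e)) z \<le> q \<and>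
      (\<forall>w'\<in>U - {w}. a z < a w')"
    using T \<open>w \<notin> P0\<close> unfolding three_def by auto
  moreover have "f + g + p = card P" "(P0 \<union> insert w P) \<inter> (U - {w}) = {}"
    using T unfolding three_def by auto
  ultimately show ?thesis
    unfolding three_def using lag v le \<open>finite P\<close> by auto
qed

text \<open>Loads of \<open>P0\<close> never conflict with the new one: they stand and leave to the
  left of column \<open>q\<close>, and if they enter through \<open>q\<close>, their earlier arrival
  settles the matter. Only comparisons with \<open>P\<close> remain.\<close>

lemma three_valid_insert:
  assumes T: "three h q a P0 P U rw cl en ex f g p" and w: "w \<in> U"
    and k: "q \<le> k"
    and e: "q < e" and f': "q \<le> f'"
    and "\<And>z. z \<in> P \<Longrightarrow> cl z = k \<Longrightarrow> rw z \<noteq> i"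
    and "\<And>z. z \<in> P \<Longrightarrow> cl z = e \<Longrightarrow> rw z \<le> i \<Longrightarrow> a w < a z"
    and "\<And>z. z \<in> P \<Longrightarrow> cl z = f' \<Longrightarrow> rw z \<le> i \<Longrightarrow> z < w"
    and "\<And>z. z \<in> P \<Longrightarrow> en z = k \<Longrightarrow> i \<le> rw z \<Longrightarrow> a z < a w"
    and "\<And>z. z \<in> P \<Longrightarrow> ex z = k \<Longrightarrow> i \<le> rw z \<Longrightarrow> w < z"
  shows "valid a (P0 \<union> insert w P) (rw(w := i)) (cl(w := k)) (en(w := e)) (ex(w := f'))"
proof -
  have "valid a (insert w (P0 \<union> P)) (rw(w := i)) (cl(w := k)) (en(w := e)) (ex(w := f'))"
  proof (rule valid_insert)
    show "valid a (P0 \<union> P) rw cl en ex" "w \<notin> P0 \<union> P"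
      using T w unfolding three_def by auto
  next
    fix z assume z: "z \<in> P0 \<union> P"
    consider "z \<in> P0" "cl z < q" "ex z < q" "en z \<le> q" "a z < a w" | "z \<in> P"
      using z w three_leftD[OF T, of z] by auto
    note c = this
    show "rw z \<noteq> i" if "cl z = k"
      using c by cases (use assms(6)[of z] that k in auto)
    show "a w < a z" if "cl z = e" "rw z \<le> i"
      using c by cases (use assms(7)[of z] that e in auto)
    show "z < w" if "cl z = f'" "rw z \<le> i"
      using c by cases (use assms(8)[of z] that f' in auto)
    show "a z < a w" if "en z = k" "i \<le> rw z"
      using c by cases (use assms(9)[of z] that in auto)
    show "w < z" if "ex z = k" "i \<le> rw z"
      using c by cases (use assms(10)[of z] that k in auto)
  qed
  then show ?thesis by simp
qed

context
  fixes h q :: nat and a :: "nat \<Rightarrow> nat" and P0 P U :: "nat set"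
    and rw cl en ex :: "nat \<Rightarrow> nat" and f g p :: nat
  assumes T: "three h q a P0 P U rw cl en ex f g p"
begin

text \<open>The second half of a pair. Only the load of \<open>L\<close> in row \<open>g\<close>
  enters across the new cell; it arrives before some pending \<open>y\<close>, and \<open>w\<close>
  arrives no earlier than \<open>y\<close>. The exit through \<open>L\<close> is covered up to row
  \<open>g\<close> by loads that depart earlier.\<close>

lemma three_middle:
  assumes g: "g < f" and w: "w \<in> U" and last: "\<And>v. v \<in> U \<Longrightarrow> v \<noteq> w \<Longrightarrow> a v < a w"
  shows "three h q a P0 (insert w P) (U - {w})
    (rw(w := g)) (cl(w := q + 1)) (en(w := q + 1)) (ex(w := q)) f (g + 1) p"
proof -
  have fg: "f = g + 1" "f \<le> h" using T g unfolding three_def by auto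
  obtain y where y: "y \<in> U" "\<And>z. z \<in> P \<Longrightarrow> cl z = q \<Longrightarrow> rw z = g \<Longrightarrow> a z < a y"
    using T g unfolding three_def by blast
  have yw: "a y \<le> a w" using last[OF y(1)] by (cases "y = w") auto
  have "valid a (P0 \<union> insert w P) (rw(w := g)) (cl(w := q + 1)) (en(w := q + 1)) (ex(w := q))"
  proof (rule three_valid_insert[OF T w], goal_cases)
    case (7 z)
    from T 7(1) show ?case
    proof (cases rule: three_cases)
      case left
      then show ?thesis using y(2)[OF 7(1)] yw 7 fg by auto
    qed (use 7 fg in auto)
  next
    case (4 z) from T 4(1) show ?case by (cases rule: three_cases) (use 4 fg w in auto)
  next
    case (5 z) from T 5(1) show ?case by (cases rule: three_cases) (use 5 fg w in auto)
  next
    case (6 z) from T 6(1) show ?case by (cases rule: three_cases) (use 6 fg w in auto)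
  next
    case (8 z) from T 8(1) show ?case by (cases rule: three_cases) (use 8 fg w in auto)
  qed auto
  then show ?thesis
    using T last fg g by (intro three_step[OF T w]) (auto simp: shape_def three_def)
qed

text \<open>As \<open>f < h\<close> and \<open>p < h\<close>, no load of \<open>M\<close> leaves
  through \<open>R\<close> yet and no load of \<open>R\<close> enters through \<open>M\<close>, so
  \<open>R\<close> serves only its own loads.\<close>

lemma three_right:
  assumes g: "f \<le> g" "f < h" "p < h" and w: "w \<in> U"
    and last: "\<And>v. v \<in> U \<Longrightarrow> v \<noteq> w \<Longrightarrow> a v < a w" and first: "\<And>v. v \<in> U \<Longrightarrow> v \<noteq> w \<Longrightarrow> w < v"
  shows "three h q a P0 (insert w P) (U - {w})
    (rw(w := p)) (cl(w := q + 2)) (en(w := q + 2)) (ex(w := q + 2)) f g (p + 1)"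
proof -
  have "valid a (P0 \<union> insert w P) (rw(w := p)) (cl(w := q + 2)) (en(w := q + 2)) (ex(w := q + 2))"
  proof (rule three_valid_insert[OF T w], goal_cases)
    case (4 z) from T 4(1) show ?case by (cases rule: three_cases) (use 4 g w in auto)
  next
    case (5 z) from T 5(1) show ?case by (cases rule: three_cases) (use 5 g w in auto)
  next
    case (6 z) from T 6(1) show ?case by (cases rule: three_cases) (use 6 g w in auto)
  next
    case (7 z) from T 7(1) show ?case by (cases rule: three_cases) (use 7 g w in auto)
  next
    case (8 z) from T 8(1) show ?case by (cases rule: three_cases) (use 8 g w in auto)
  qed auto
  then show ?thesis
    using T last first g by (intro three_step[OF T w]) (auto simp: shape_def three_def)
qed

text \<open>Entering through \<open>M\<close> is safe because every load assigned there arrives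
  after all of \<open>U\<close>. While \<open>p < h\<close>, the new load opens a pair, and the last
  arrival \<open>y\<close> witnesses the lag; if \<open>g = h\<close>, then \<open>M\<close> is full
  and cannot lag.\<close>

lemma three_left:
  assumes g: "f \<le> g" "f < h" "p < h \<or> g = h" and w: "w \<in> U"
    and last: "p < h \<Longrightarrow> y \<in> U \<and> a w < a y" and first: "\<And>v. v \<in> U \<Longrightarrow> v \<noteq> w \<Longrightarrow> w < v"
  shows "three h q a P0 (insert w P) (U - {w})
    (rw(w := f)) (cl(w := q)) (en(w := q + 1)) (ex(w := q)) (f + 1) g p"
proof -
  have "valid a (P0 \<union> insert w P) (rw(w := f)) (cl(w := q)) (en(w := q + 1)) (ex(w := q))"
  proof (rule three_valid_insert[OF T w], goal_cases)
    case (4 z) from T 4(1) show ?case by (cases rule: three_cases) (use 4 g w in auto)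
  next
    case (5 z) from T 5(1) show ?case by (cases rule: three_cases) (use 5 g w in auto)
  next
    case (6 z) from T 6(1) show ?case by (cases rule: three_cases) (use 6 g w in auto)
  next
    case (7 z) from T 7(1) show ?case by (cases rule: three_cases) (use 7 g w in auto)
  next
    case (8 z) from T 8(1) show ?case by (cases rule: three_cases) (use 8 g w in auto)
  qed auto
  moreover have "\<exists>y\<in>U - {w}. \<forall>z\<in>insert w P. (cl(w := q)) z = q \<and> (rw(w := f)) z = g \<longrightarrow> a z < a y"
    if "g < f + 1"
  proof -
    have gf: "g = f" "p < h" using that g by auto
    then have y: "y \<in> U - {w}" "a w < a y" using last by auto
    have "\<not> (cl z = q \<and> rw z = g)" if "z \<in> P" for z
      using T that by (cases rule: three_cases) (use gf in auto)
    then show ?thesis using y by (intro bexI[of _ y]) auto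
  qed
  ultimately show ?thesis
    using T first g by (intro three_step[OF T w]) (auto simp: shape_def three_def)
qed

text \<open>As \<open>R\<close> is full, all its loads depart before \<open>w\<close> and no further
  load can block the exit through it. By \<open>f \<le> g\<close>, no load of \<open>L\<close>
  enters across the new cell.\<close>

lemma three_middle_right:
  assumes g: "f \<le> g" "p = h" "g < h" and w: "w \<in> U"
    and last: "\<And>v. v \<in> U \<Longrightarrow> v \<noteq> w \<Longrightarrow> a v < a w"
  shows "three h q a P0 (insert w P) (U - {w})
    (rw(w := g)) (cl(w := q + 1)) (en(w := q + 1)) (ex(w := q + 2)) f (g + 1) p"
proof -
  have "valid a (P0 \<union> insert w P) (rw(w := g)) (cl(w := q + 1)) (en(w := q + 1)) (ex(w := q + 2))"
  proof (rule three_valid_insert[OF T w], goal_cases)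
    case (4 z) from T 4(1) show ?case by (cases rule: three_cases) (use 4 g w in auto)
  next
    case (5 z) from T 5(1) show ?case by (cases rule: three_cases) (use 5 g w in auto)
  next
    case (6 z) from T 6(1) show ?case by (cases rule: three_cases) (use 6 g w in auto)
  next
    case (7 z) from T 7(1) show ?case by (cases rule: three_cases) (use 7 g w in auto)
  next
    case (8 z) from T 8(1) show ?case by (cases rule: three_cases) (use 8 g w in auto)
  qed auto
  then show ?thesis
    using T last g by (intro three_step[OF T w]) (auto simp: shape_def three_def)
qed

text \<open>The loads of \<open>M\<close>, which is full, arrive after all of \<open>U\<close>, so
  \<open>w\<close> can enter through it; those already in \<open>R\<close> are further to the front
  and depart before \<open>w\<close>.\<close>

lemma three_right_middle:
  assumes g: "f = h" "g = h" "p < h" and w: "w \<in> U"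
    and first: "\<And>v. v \<in> U \<Longrightarrow> v \<noteq> w \<Longrightarrow> w < v"
  shows "three h q a P0 (insert w P) (U - {w})
    (rw(w := p)) (cl(w := q + 2)) (en(w := q + 1)) (ex(w := q + 2)) f g (p + 1)"
proof -
  have "valid a (P0 \<union> insert w P) (rw(w := p)) (cl(w := q + 2)) (en(w := q + 1)) (ex(w := q + 2))"
  proof (rule three_valid_insert[OF T w], goal_cases)
    case (4 z) from T 4(1) show ?case by (cases rule: three_cases) (use 4 g w in auto)
  next
    case (5 z) from T 5(1) show ?case by (cases rule: three_cases) (use 5 g w in auto)
  next
    case (6 z) from T 6(1) show ?case by (cases rule: three_cases) (use 6 g w in auto)
  next
    case (7 z) from T 7(1) show ?case by (cases rule: three_cases) (use 7 g w in auto)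
  next
    case (8 z) from T 8(1) show ?case by (cases rule: three_cases) (use 8 g w in auto)
  qed auto
  then show ?thesis
    using T first g by (intro three_step[OF T w]) (auto simp: shape_def three_def)
qed

end

section \<open>The program\<close>

text \<open>\<open>u\<close> is the sum of the labels not yet obtained. The index
  \<open>3 * h - 1\<close> is reached only in a final group of \<open>3 * h\<close> loads, when a
  single label is left and \<open>u\<close> equals it.\<close>

definition read_loads :: com where
  "read_loads = loop ''i''
     (If (Less (Var ''i'') (Sub (Mul (Num 3) (Var ''h'')) (Num 1)))
        (Next ''x'') (''x'' ::= Var ''u'') ;;
      AssignArr ''buf'' (Var ''i'') (Var ''x'') ;;
      AssignArr ''key'' (Var ''i'') (Var ''x'') ;;
      ''u'' ::= Sub (Var ''u'') (Var ''x''))"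

definition put :: "aexp \<Rightarrow> aexp \<Rightarrow> aexp \<Rightarrow> aexp \<Rightarrow> com" where
  "put i k e x =
     AssignArr ''row'' (Var ''x'') i ;; AssignArr ''col'' (Var ''x'') k ;;
     AssignArr ''in'' (Var ''x'') e ;; AssignArr ''out'' (Var ''x'') x"

definition place_block :: com where
  "place_block = loop ''i''
     (''x'' ::= Arr ''key'' (Var ''i'') ;;
      put (Var ''i'') (Var ''b'') (Add (Var ''b'') (Num 1)) (Var ''b''))"

definition store_loads :: com where
  "store_loads = loop ''i''
     (''x'' ::= Arr ''buf'' (Var ''i'') ;;
      DoStore [(Num 0, Arr ''in'' (Var ''x'')), (Arr ''row'' (Var ''x''), Arr ''in'' (Var ''x'')),
        (Arr ''row'' (Var ''x''), Arr ''col'' (Var ''x''))])"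

abbreviation column_expr :: "nat \<Rightarrow> aexp" where
  "column_expr k \<equiv> Add (Var ''q'') (Num k)"

text \<open>The branches realize \<open>three_middle\<close>; \<open>three_right\<close> and
  \<open>three_left\<close>; then, for a full \<open>R\<close>, \<open>three_middle_right\<close>
  and again \<open>three_left\<close>; and finally \<open>three_right_middle\<close>. Where the last
  arrival is placed, \<open>x\<close> is overwritten by \<open>y\<close> because \<open>put\<close>
  acts on \<open>x\<close>.\<close>

definition place_one :: com where
  "place_one =
     If (Less (Var ''g'') (Var ''f''))
       (''x'' ::= Var ''y'' ;;
        put (Var ''g'') (column_expr 1) (column_expr 1) (column_expr 0) ;;
        ''g'' ::= Add (Var ''g'') (Num 1))
     (If (Conj (Less (Var ''f'') (Var ''h'')) (Less (Var ''p'') (Var ''h'')))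
       (If (Eq (Var ''x'') (Var ''y''))
         (put (Var ''p'') (column_expr 2) (column_expr 2) (column_expr 2) ;;
          ''p'' ::= Add (Var ''p'') (Num 1))
         (put (Var ''f'') (column_expr 0) (column_expr 1) (column_expr 0) ;;
          ''f'' ::= Add (Var ''f'') (Num 1)))
     (If (Less (Var ''g'') (Var ''h''))
       (''x'' ::= Var ''y'' ;;
        put (Var ''g'') (column_expr 1) (column_expr 1) (column_expr 2) ;;
        ''g'' ::= Add (Var ''g'') (Num 1))
     (If (Less (Var ''f'') (Var ''h''))
       (put (Var ''f'') (column_expr 0) (column_expr 1) (column_expr 0) ;;
        ''f'' ::= Add (Var ''f'') (Num 1))
       (put (Var ''p'') (column_expr 2) (column_expr 1) (column_expr 2) ;;
        ''p'' ::= Add (Var ''p'') (Num 1)))))"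

text \<open>Deletion is lazy: placed loads are only marked in \<open>done\<close>, and both pointers
  skip marked entries. A call moves one pointer by one or places one load, so its cost is
  constant.\<close>

definition place_next :: com where
  "place_next =
     If (Eq (Arr ''done'' (Arr ''key'' (Var ''i''))) (Num 1))
       (''i'' ::= Add (Var ''i'') (Num 1))
     (If (Eq (Arr ''done'' (Arr ''buf'' (Sub (Var ''j'') (Num 1)))) (Num 1))
       (''j'' ::= Sub (Var ''j'') (Num 1))
       (''x'' ::= Arr ''key'' (Var ''i'') ;; ''y'' ::= Arr ''buf'' (Sub (Var ''j'') (Num 1)) ;;
        place_one ;;
        AssignArr ''done'' (Var ''x'') (Num 1) ;; ''t'' ::= Sub (Var ''t'') (Num 1)))"

definition place_three :: com where
  "place_three =
     ''f'' ::= Num 0 ;; ''g'' ::= Num 0 ;; ''p'' ::= Num 0 ;; ''i'' ::= Num 0 ;;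
     ''j'' ::= Var ''m'' ;; ''t'' ::= Var ''m'' ;;
     While (Less (Num 0) (Var ''t'')) place_next"

lemma mods_read_loads:
  "mvars read_loads = {''i'', ''x'', ''u''}" "marrs read_loads = {''buf'', ''key''}"
  "\<not> acts read_loads"
  by (auto simp: read_loads_def mods_loop)

lemma mods_place_block:
  "mvars place_block = {''i'', ''x''}" "marrs place_block = {''row'', ''col'', ''in'', ''out''}"
  "\<not> reads place_block" "\<not> acts place_block"
  by (auto simp: place_block_def mods_loop put_def)

lemma mods_store_loads:
  "mvars store_loads = {''i'', ''x''}" "marrs store_loads = {}" "\<not> reads store_loads"
  by (auto simp: store_loads_def mods_loop)

lemma mods_place_next:
  "mvars place_next = {''f'', ''g'', ''p'', ''i'', ''j'', ''t'', ''x'', ''y''}"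
  "marrs place_next = {''row'', ''col'', ''in'', ''out'', ''done''}"
  "\<not> reads place_next" "\<not> acts place_next"
  by (auto simp: place_next_def place_one_def put_def)

lemma mods_place_three:
  "mvars place_three = {''f'', ''g'', ''p'', ''i'', ''j'', ''t'', ''x'', ''y''}"
  "marrs place_three = {''row'', ''col'', ''in'', ''out'', ''done''}"
  "\<not> reads place_three" "\<not> acts place_three"
  by (auto simp: place_three_def mods_place_next)

text \<open>\<open>l\<close> may exceed \<open>3 * h - 1\<close> because \<open>h\<close> can be
  smaller than the number of rows. The first \<open>q\<close> columns take complete groups, and at
  most three columns of loads are left. Among the word bounds, \<open>9 * h + 1\<close> serves for
  sorting \<open>3 * h\<close> keys and \<open>n * (n + 1)\<close> dominates all label sums.\<close>

locale storage =
  fixes h c n q l B :: nat and A :: "nat list" and a :: "nat \<Rightarrow> nat"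
  assumes l: "3 * h \<le> l + 1" and h: "1 \<le> h" and q: "q + 3 \<le> c" and n: "length A = n"
    and A: "distinct A" "set A = {1..n}" and a: "\<And>i. i < n \<Longrightarrow> a (A ! i) = i"
    and qn: "q * h \<le> n" "n \<le> q * h + 3 * h"
    and B: "9 * h + 1 < B" "n + 1 < B" "c + 1 < B" "n * (n + 1) < B"
begin

section \<open>Reading a group, filling a column and storing\<close>

definition placed :: "nat set \<Rightarrow> mstate \<Rightarrow> bool" where
  "placed P s \<longleftrightarrow>
     valid a P (arr s ''row'') (arr s ''col'') (arr s ''in'') (arr s ''out'') \<and>
     fits h c P (arr s ''row'') (arr s ''col'') (arr s ''in'') (arr s ''out'')"

text \<open>Past actions are described through the current arrays, so that the final arrays account
  for the whole plan.\<close>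

definition planned :: "nat \<Rightarrow> mstate \<Rightarrow> bool" where
  "planned k s \<longleftrightarrow> nstored s = k \<and>
     plan s = map (store_act (arr s ''row'') (arr s ''col'') (arr s ''in'')) (take k A)"

lemma load_le: "v < n \<Longrightarrow> A ! v \<le> n" "v < n \<Longrightarrow> A ! v < B"
  using A(2) n B(2) nth_mem[of v A] by auto

text \<open>Keeps \<open>u\<close> below the word bound at all times.\<close>

lemma sum_loads: "(\<Sum>v\<in>{k..<n}. A ! v) < B"
proof -
  have "(\<Sum>v\<in>{k..<n}. A ! v) \<le> (\<Sum>v\<in>{0..<n}. A ! v)"
    by (intro sum_mono2) auto
  also have "\<dots> = sum_list A"
    by (simp add: sum_list_sum_nth n)
  also have "\<dots> = \<Sum>{1..n}"
    using sum_list_distinct_conv_sum_set[OF A(1), of "\<lambda>x. x"] A(2) by simp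
  also have "\<dots> \<le> n * (n + 1)"
    using Sum_Icc_nat[of 1 n] by auto
  finally show ?thesis using B by simp
qed

lemma sum_loads_all: "(\<Sum>v\<in>{0..<n}. A ! v) = n * (n + 1) div 2"
proof -
  have "(\<Sum>v\<in>{0..<n}. A ! v) = \<Sum>{1..n}"
    using sum_list_distinct_conv_sum_set[OF A(1), of "\<lambda>x. x"] A(2)
    by (simp add: sum_list_sum_nth n)
  also have "\<dots> = n * (n + 1) div 2"
    using Sum_Icc_nat[of 1 n] by auto
  finally show ?thesis .
qed

text \<open>No load of the group is stored before all are read. Hence the \<open>v\<close>-th of
  them is readable for \<open>v < l\<close>, which covers \<open>v < 3 * h - 1\<close>.\<close>

lemma wp_read_loads:
  assumes m: "k + m \<le> n" "m \<le> 3 * h" "m = 3 * h \<Longrightarrow> k + m = n"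
    and s: "scal s ''h'' = h" "scal s ''m'' = m" "scal s ''u'' = (\<Sum>v\<in>{k..<n}. A ! v)"
      "nread s = k" "nstored s = k"
  shows "wp l A B read_loads (\<lambda>t s'. t \<le> 40 * (m + 1) \<and>
      (\<forall>v<m. arr s' ''buf'' v = A ! (k + v) \<and> arr s' ''key'' v = A ! (k + v)) \<and>
      scal s' ''u'' = (\<Sum>v\<in>{k + m..<n}. A ! v) \<and> nread s' = k + min m (3 * h - 1)) s"
proof -
  define J where "J v s' \<longleftrightarrow> scal s' ''u'' = (\<Sum>v\<in>{k + v..<n}. A ! v) \<and>
      (\<forall>w<v. arr s' ''buf'' w = A ! (k + w) \<and> arr s' ''key'' w = A ! (k + w)) \<and>
      nread s' = k + min v (3 * h - 1)" for v and s' :: mstate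
  have "wp l A B read_loads (\<lambda>t s'. t \<le> (30 + 8) * (scal s ''m'' + 1) \<and>
      J (scal s ''m'') s' \<and> same read_loads s s') s"
    unfolding read_loads_def
  proof (rule wp_loop)
    show "J 0 s" using s by (simp add: J_def)
    show "scal s ''m'' < B" using s m B by simp
    show "J v (s\<lparr>scal := (scal s)(''i'' := w)\<rparr>)" if "J v s" for v w s
      using that by (simp add: J_def)
  next
    fix v s1
    assume J: "J v s1" and sm: "same (loop ''i'' (If (Less (Var ''i'') (Sub (Mul (Num 3) (Var ''h'')) (Num 1)))
        (Next ''x'') (''x'' ::= Var ''u'') ;;
      AssignArr ''buf'' (Var ''i'') (Var ''x'') ;;
      AssignArr ''key'' (Var ''i'') (Var ''x'') ;;
      ''u'' ::= Sub (Var ''u'') (Var ''x''))) s s1" and v: "scal s1 ''i'' = v" "v < scal s ''m''"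
    have s1: "scal s1 ''h'' = h" "nstored s1 = k"
      using sm s by (auto simp: same_def mods_loop)
    have kv: "k + v < n" "v < m" "v < B" using v m s B by auto
    have sum: "(\<Sum>v\<in>{k + v..<n}. A ! v) = A ! (k + v) + (\<Sum>v\<in>{k + Suc v..<n}. A ! v)"
      using kv by (simp add: sum.atLeast_Suc_lessThan)
    have b: "A ! (k + v) < B" using load_le kv by simp
    have sB: "(\<Sum>v\<in>{k + Suc v..<n}. A ! v) < B" by (rule sum_loads)
    have J2: "J (Suc v) s'" if "scal s' ''u'' = (\<Sum>v\<in>{k + Suc v..<n}. A ! v)"
      "arr s' ''buf'' = (arr s1 ''buf'')(v := A ! (k + v))"
      "arr s' ''key'' = (arr s1 ''key'')(v := A ! (k + v))"
      "nread s' = k + min (Suc v) (3 * h - 1)" for s'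
      using that J by (auto simp: J_def less_Suc_eq)
    show "wp l A B (If (Less (Var ''i'') (Sub (Mul (Num 3) (Var ''h'')) (Num 1)))
        (Next ''x'') (''x'' ::= Var ''u'') ;;
      AssignArr ''buf'' (Var ''i'') (Var ''x'') ;;
      AssignArr ''key'' (Var ''i'') (Var ''x'') ;;
      ''u'' ::= Sub (Var ''u'') (Var ''x'')) (\<lambda>t s'. t \<le> 30 \<and> J (Suc v) s') s1"
    proof (cases "v < 3 * h - 1")
      case True
      then have nr: "nread s1 = k + v" using J by (simp add: J_def)
      show ?thesis
        unfolding wp_simps
        using True v(1) s1 nr kv b sB n l J sum by (auto intro!: J2 simp: J_def)
    next
      case False
      then have "m = 3 * h" using kv m(2) by linarith
      then have "k + v = n - 1" "n > 0" using False kv m(3) by auto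
      then have e: "(\<Sum>v\<in>{k + v..<n}. A ! v) = A ! (k + v)"
        by (cases n) auto
      then have "scal s1 ''u'' = A ! (k + v)" "(\<Sum>v\<in>{k + Suc v..<n}. A ! v) = 0"
        using J sum unfolding J_def by auto
      moreover have "nread s1 = k + (3 * h - 1)" "min (Suc v) (3 * h - 1) = 3 * h - 1"
        using J False by (auto simp: J_def)
      ultimately show ?thesis
        unfolding wp_simps
        using False v(1) s1 kv b sB n by simp (rule J2; simp)
    qed
  qed auto
  then show ?thesis
    by (rule wp_conseq) (auto simp: J_def s)
qed

lemma fits_insert:
  assumes "fits h c P rw cl en ex" "i < h" "k < c" "e < c" "f < c" "nearby e k" "nearby f k"
  shows "fits h c (insert w P) (rw(w := i)) (cl(w := k)) (en(w := e)) (ex(w := f))"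
  using assms unfolding fits_def by auto

text \<open>All loads stored so far belong to \<open>P\<close>, so writing the entries of a load
  outside \<open>P\<close> does not change the description of past actions.\<close>

lemma planned_put:
  assumes "planned k s" "set (take k A) \<subseteq> P" "w \<notin> P" "nstored s' = nstored s" "plan s' = plan s"
    "arr s' ''row'' = (arr s ''row'')(w := i)" "arr s' ''col'' = (arr s ''col'')(w := v)"
    "arr s' ''in'' = (arr s ''in'')(w := e)"
  shows "planned k s'"
  using assms unfolding planned_def by (auto simp: store_act_def)

text \<open>Column \<open>b + 1\<close> is empty and thus free for entering, and sorting lets the
  loads further to the front in column \<open>b\<close> depart earlier. Older loads use column
  \<open>b\<close> at most for entering, and they arrive earlier.\<close>

lemma wp_place_block:
  assumes s: "scal s ''m'' = m" "m \<le> h" "scal s ''b'' = b" "b + 1 < c"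
    and key: "arr s ''key'' = K" "\<And>u v. u < v \<Longrightarrow> v < m \<Longrightarrow> K u < K v" "\<And>u. u < m \<Longrightarrow> K u < B"
      "\<And>u z. u < m \<Longrightarrow> z \<in> P \<Longrightarrow> a z < a (K u)"
    and P: "placed P s" "planned k s" "set (take k A) \<subseteq> P"
      "\<And>z. z \<in> P \<Longrightarrow> arr s ''col'' z < b \<and> arr s ''out'' z < b \<and> arr s ''in'' z \<le> b"
  shows "wp l A B place_block (\<lambda>t s'. t \<le> 40 * (m + 1) \<and>
      placed (P \<union> K ` {..<m}) s' \<and> planned k s' \<and>
      (\<forall>z\<in>P \<union> K ` {..<m}. arr s' ''col'' z < b + 1 \<and> arr s' ''out'' z < b + 1 \<and>
        arr s' ''in'' z \<le> b + 1)) s"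
proof -
  define J where "J v s' \<longleftrightarrow> placed (P \<union> K ` {..<v}) s' \<and> planned k s' \<and>
      (\<forall>z\<in>P. arr s' ''col'' z < b \<and> arr s' ''out'' z < b \<and> arr s' ''in'' z \<le> b) \<and>
      (\<forall>u<v. arr s' ''row'' (K u) = u \<and> arr s' ''col'' (K u) = b \<and> arr s' ''out'' (K u) = b \<and>
        arr s' ''in'' (K u) = b + 1)" for v and s' :: mstate
  have KP: "K u \<notin> P" if "u < m" for u
    using key(4)[OF that, of "K u"] by auto
  have "wp l A B place_block (\<lambda>t s'. t \<le> (30 + 8) * (scal s ''m'' + 1) \<and>
      J (scal s ''m'') s' \<and> same place_block s s') s"
    unfolding place_block_def
  proof (rule wp_loop)
    show "J 0 s" using P by (simp add: J_def)
    show "scal s ''m'' < B" using s B by simp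
    show "J v (s\<lparr>scal := (scal s)(''i'' := w)\<rparr>)" if "J v s" for v w s
      using that by (simp add: J_def placed_def planned_def)
    show "''m'' \<notin> mvars (''x'' ::= Arr ''key'' (Var ''i'') ;;
      put (Var ''i'') (Var ''b'') (Add (Var ''b'') (Num 1)) (Var ''b''))"
      "''i'' \<notin> mvars (''x'' ::= Arr ''key'' (Var ''i'') ;;
      put (Var ''i'') (Var ''b'') (Add (Var ''b'') (Num 1)) (Var ''b''))"
      by (auto simp: put_def)
  next
    fix v s1
    assume J: "J v s1" and sm: "same (loop ''i'' (''x'' ::= Arr ''key'' (Var ''i'') ;;
      put (Var ''i'') (Var ''b'') (Add (Var ''b'') (Num 1)) (Var ''b''))) s s1"
      and "scal s1 ''i'' = v" "v < scal s ''m''"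
    then have s1: "scal s1 ''b'' = b" "arr s1 ''key'' = K" "scal s1 ''i'' = v" "v < m"
      using s key by (auto simp: same_def mods_loop put_def)
    let ?P = "P \<union> K ` {..<v}"
    let ?w = "K v"
    have w: "?w \<notin> ?P"
      using KP[OF s1(4)] key(2) s1(4) by force
    have val: "valid a (insert ?w ?P) ((arr s1 ''row'')(?w := v)) ((arr s1 ''col'')(?w := b))
        ((arr s1 ''in'')(?w := b + 1)) ((arr s1 ''out'')(?w := b))"
    proof (rule valid_insert)
      show "valid a ?P (arr s1 ''row'') (arr s1 ''col'') (arr s1 ''in'') (arr s1 ''out'')"
        using J by (simp add: J_def placed_def)
      show "?w \<notin> ?P" by (rule w)
    next
      fix z assume z: "z \<in> ?P"
      consider "z \<in> P" "arr s1 ''col'' z < b" "arr s1 ''out'' z < b" "arr s1 ''in'' z \<le> b" "a z < a ?w"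
        | u where "u < v" "z = K u" "arr s1 ''row'' z = u" "arr s1 ''col'' z = b" "arr s1 ''out'' z = b"
          "arr s1 ''in'' z = b + 1" "z < ?w"
        using z J key(4)[OF s1(4)] key(2) s1(4) unfolding J_def by auto
      note c = this
      show "arr s1 ''row'' z \<noteq> v" if "arr s1 ''col'' z = b"
        using c by cases (use that in auto)
      show "a ?w < a z" if "arr s1 ''col'' z = b + 1" "arr s1 ''row'' z \<le> v"
        using c by cases (use that in auto)
      show "z < ?w" if "arr s1 ''col'' z = b" "arr s1 ''row'' z \<le> v"
        using c by cases (use that in auto)
      show "a z < a ?w" if "arr s1 ''in'' z = b" "v \<le> arr s1 ''row'' z"
        using c by cases (use that in auto)
      show "?w < z" if "arr s1 ''out'' z = b" "v \<le> arr s1 ''row'' z"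
        using c by cases (use that in auto)
    qed
    have fit: "fits h c (insert ?w ?P) ((arr s1 ''row'')(?w := v)) ((arr s1 ''col'')(?w := b))
        ((arr s1 ''in'')(?w := b + 1)) ((arr s1 ''out'')(?w := b))"
      using J s s1 by (intro fits_insert) (auto simp: J_def placed_def nearby_def)
    have J2: "J (Suc v) s'" if s': "nstored s' = nstored s1" "plan s' = plan s1"
      "arr s' ''row'' = (arr s1 ''row'')(?w := v)" "arr s' ''col'' = (arr s1 ''col'')(?w := b)"
      "arr s' ''in'' = (arr s1 ''in'')(?w := b + 1)" "arr s' ''out'' = (arr s1 ''out'')(?w := b)" for s'
    proof -
      have "planned k s'"
        using J P(3) KP[OF s1(4)] by (intro planned_put[where s = s1 and P = P and w = ?w, OF _ _ _ s'(1-5)])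
          (auto simp: J_def)
      moreover have "P \<union> K ` {..<Suc v} = insert ?w ?P"
        by (auto simp: lessThan_Suc)
      moreover have "z \<noteq> ?w" if "z \<in> P" for z using that KP[OF s1(4)] by auto
      moreover have "K u \<noteq> ?w" if "u < v" for u using key(2)[OF that s1(4)] by simp
      ultimately show ?thesis
        using J val fit unfolding J_def placed_def s' by (auto simp: less_Suc_eq)
    qed
    show "wp l A B (''x'' ::= Arr ''key'' (Var ''i'') ;;
      put (Var ''i'') (Var ''b'') (Add (Var ''b'') (Num 1)) (Var ''b''))
      (\<lambda>t s'. t \<le> 30 \<and> J (Suc v) s') s1"
      unfolding wp_simps put_def
      using s1 s(2,4) B key(3)[OF s1(4)] by simp (rule J2; simp)
  qed auto
  then show ?thesis
    by (rule wp_conseq) (auto simp: J_def s intro: less_SucI le_SucI)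
qed

lemma wp_store_loads:
  assumes s: "scal s ''m'' = m" "k + m \<le> n" "planned k s"
    and buf: "\<And>v. v < m \<Longrightarrow> arr s ''buf'' v = A ! (k + v)"
  shows "wp l A B store_loads (\<lambda>t s'. t \<le> 40 * (m + 1) \<and> planned (k + m) s') s"
proof -
  define C where "C = (''x'' ::= Arr ''buf'' (Var ''i'') ;;
      DoStore [(Num 0, Arr ''in'' (Var ''x'')), (Arr ''row'' (Var ''x''), Arr ''in'' (Var ''x'')),
        (Arr ''row'' (Var ''x''), Arr ''col'' (Var ''x''))])"
  have C: "mvars C = {''x''}" "marrs C = {}" by (auto simp: C_def)
  have "wp l A B store_loads (\<lambda>t s'. t \<le> (30 + 8) * (scal s ''m'' + 1) \<and>
      planned (k + scal s ''m'') s' \<and> same store_loads s s') s"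
    unfolding store_loads_def C_def[symmetric]
  proof (rule wp_loop[where J = "\<lambda>v. planned (k + v)"])
    show "planned (k + v) (s\<lparr>scal := (scal s)(''i'' := w)\<rparr>)" if "planned (k + v) s" for v w s
      using that by (simp add: planned_def)
  next
    fix v s1
    assume J: "planned (k + v) s1" and sm: "same (loop ''i'' C) s s1"
      and "scal s1 ''i'' = v" "v < scal s ''m''"
    then have s1: "scal s1 ''i'' = v" "v < m"
      using s(1) by simp_all
    have ar: "arr s1 = arr s"
      using sm by (simp add: same_def mods_loop C fun_eq_iff)
    have kv: "k + v < n" using s s1 by simp
    then have "take (Suc (k + v)) A = take (k + v) A @ [A ! (k + v)]"
      using n by (simp add: take_Suc_conv_app_nth)
    then show "wp l A B C (\<lambda>t s'. t \<le> 30 \<and> planned (k + Suc v) s') s1"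
      unfolding wp_simps C_def
      using J s1 ar kv buf[OF s1(2)] load_le(2)[OF kv] n
      by (simp add: planned_def cval_def ccost_def store_act_def del: trace.simps)
  qed (use s B in \<open>auto simp: C\<close>)
  then show ?thesis
    by (rule wp_conseq) (auto simp: s)
qed

end

text \<open>The four entries are evaluated between array updates. As their values depend on scalars
  only, all of them may be taken in the initial state.\<close>

lemma wp_put:
  assumes "\<And>s'. scal s' = scal s \<Longrightarrow> aval i s' = aval i s" "\<And>s'. scal s' = scal s \<Longrightarrow> aval k s' = aval k s"
    "\<And>s'. scal s' = scal s \<Longrightarrow> aval e s' = aval e s" "\<And>s'. scal s' = scal s \<Longrightarrow> aval x s' = aval x s"
    and "scal s ''x'' < B" "aval i s < B" "aval k s < B" "aval e s < B" "aval x s < B"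
    and "Q (2 + acost i + (2 + acost k + (2 + acost e + (2 + acost x)))) (s\<lparr>arr := (arr s)
      (''row'' := (arr s ''row'')(scal s ''x'' := aval i s),
       ''col'' := (arr s ''col'')(scal s ''x'' := aval k s),
       ''in'' := (arr s ''in'')(scal s ''x'' := aval e s),
       ''out'' := (arr s ''out'')(scal s ''x'' := aval x s))\<rparr>)"
  shows "wp l A B (put i k e x) Q s"
proof -
  have "aval i (s\<lparr>arr := X\<rparr>) = aval i s" "aval k (s\<lparr>arr := X\<rparr>) = aval k s"
    "aval e (s\<lparr>arr := X\<rparr>) = aval e s" "aval x (s\<lparr>arr := X\<rparr>) = aval x s" for X
    using assms(1-4)[of "s\<lparr>arr := X\<rparr>"] by simp_all
  then show ?thesis
    unfolding put_def wp_simps using assms(5-) by simp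
qed

lemma wp_If_true:
  "bval b s \<Longrightarrow> wp l A B C1 (\<lambda>t. Q (1 + bcost b + t)) s \<Longrightarrow> wp l A B (If b C1 C2) Q s"
  by (simp add: wp_simps)

lemma wp_If_false:
  "\<not> bval b s \<Longrightarrow> wp l A B C2 (\<lambda>t. Q (1 + bcost b + t)) s \<Longrightarrow> wp l A B (If b C1 C2) Q s"
  by (simp add: wp_simps)

text \<open>One format for all outcomes of \<open>place_one\<close>, so that the bookkeeping after a
  placement is verified only once.\<close>

definition effect :: "mstate \<Rightarrow> nat \<Rightarrow> nat \<Rightarrow> nat \<Rightarrow> nat \<Rightarrow> nat \<Rightarrow> nat \<Rightarrow> nat \<Rightarrow> nat \<Rightarrow> mstate \<Rightarrow> bool" where
  "effect s w i k e x f g p s' \<longleftrightarrow>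
     scal s' ''x'' = w \<and> scal s' ''f'' = f \<and> scal s' ''g'' = g \<and> scal s' ''p'' = p \<and>
     scal s' ''i'' = scal s ''i'' \<and> scal s' ''j'' = scal s ''j'' \<and> scal s' ''t'' = scal s ''t'' \<and>
     arr s' ''row'' = (arr s ''row'')(w := i) \<and> arr s' ''col'' = (arr s ''col'')(w := k) \<and>
     arr s' ''in'' = (arr s ''in'')(w := e) \<and> arr s' ''out'' = (arr s ''out'')(w := x) \<and>
     arr s' ''done'' = arr s ''done'' \<and> nstored s' = nstored s \<and> plan s' = plan s"

lemma wp_place_one:
  assumes B: "x < B" "y < B" "h + 1 < B" "q + 2 < B" and le: "f \<le> h" "g \<le> h" "p \<le> h"
    and s: "scal s ''x'' = x" "scal s ''y'' = y" "scal s ''h'' = h" "scal s ''q'' = q"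
      "scal s ''f'' = f" "scal s ''g'' = g" "scal s ''p'' = p"
  shows
    "g < f \<Longrightarrow>
       wp l A B place_one (\<lambda>t s'. t \<le> 60 \<and> effect s y g (q + 1) (q + 1) q f (g + 1) p s') s"
    "f \<le> g \<Longrightarrow> f < h \<Longrightarrow> p < h \<Longrightarrow> x = y \<Longrightarrow>
       wp l A B place_one (\<lambda>t s'. t \<le> 60 \<and> effect s x p (q + 2) (q + 2) (q + 2) f g (p + 1) s') s"
    "f \<le> g \<Longrightarrow> f < h \<Longrightarrow> p < h \<Longrightarrow> x \<noteq> y \<Longrightarrow>
       wp l A B place_one (\<lambda>t s'. t \<le> 60 \<and> effect s x f q (q + 1) q (f + 1) g p s') s"
    "f \<le> g \<Longrightarrow> p = h \<Longrightarrow> g < h \<Longrightarrow>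
       wp l A B place_one (\<lambda>t s'. t \<le> 60 \<and> effect s y g (q + 1) (q + 1) (q + 2) f (g + 1) p s') s"
    "f \<le> g \<Longrightarrow> p = h \<Longrightarrow> g = h \<Longrightarrow> f < h \<Longrightarrow>
       wp l A B place_one (\<lambda>t s'. t \<le> 60 \<and> effect s x f q (q + 1) q (f + 1) g p s') s"
    "f = h \<Longrightarrow> g = h \<Longrightarrow> p < h \<Longrightarrow>
       wp l A B place_one (\<lambda>t s'. t \<le> 60 \<and> effect s x p (q + 2) (q + 1) (q + 2) f g (p + 1) s') s"
  subgoal unfolding place_one_def
    apply (insert B le s)
    apply (rule wp_If_true, simp)
    apply (unfold wp_simps(4))
    apply (unfold wp_simps(2))
    apply (rule conjI, simp)
    by (rule wp_put; simp add: wp_simps effect_def)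
  subgoal unfolding place_one_def
    apply (insert B le s)
    apply (rule wp_If_false, simp, rule wp_If_true, simp, rule wp_If_true, simp)
    apply (unfold wp_simps(4))
    by (rule wp_put; simp add: wp_simps effect_def)
  subgoal unfolding place_one_def
    apply (insert B le s)
    apply (rule wp_If_false, simp, rule wp_If_true, simp, rule wp_If_false, simp)
    apply (unfold wp_simps(4))
    by (rule wp_put; simp add: wp_simps effect_def)
  subgoal unfolding place_one_def
    apply (insert B le s)
    apply (rule wp_If_false, simp, rule wp_If_false, simp, rule wp_If_true, simp)
    apply (unfold wp_simps(4))
    apply (unfold wp_simps(2))
    apply (rule conjI, simp)
    by (rule wp_put; simp add: wp_simps effect_def)
  subgoal unfolding place_one_def
    apply (insert B le s)
    apply (rule wp_If_false, simp, rule wp_If_false, simp, rule wp_If_false, simp, rule wp_If_true, simp)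
    apply (unfold wp_simps(4))
    by (rule wp_put; simp add: wp_simps effect_def)
  subgoal unfolding place_one_def
    apply (insert B le s)
    apply (rule wp_If_false, simp, rule wp_If_false, simp, rule wp_If_false, simp, rule wp_If_false, simp)
    apply (unfold wp_simps(4))
    by (rule wp_put; simp add: wp_simps effect_def)
  done

section \<open>Correctness of the placement in three columns\<close>

context storage
begin

lemma wp_place_three:
  assumes s: "scal s ''m'' = m" "m \<le> 3 * h" "scal s ''h'' = h" "scal s ''q'' = q"
    and key: "arr s ''key'' = K" "\<And>u v. u < v \<Longrightarrow> v < m \<Longrightarrow> K u < K v" "\<And>u. u < m \<Longrightarrow> K u < B"
    and buf: "arr s ''buf'' = F" "F ` {..<m} = K ` {..<m}"
      "\<And>u v. u < v \<Longrightarrow> v < m \<Longrightarrow> a (F u) < a (F v)"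
    and mark: "\<And>u. u < m \<Longrightarrow> arr s ''done'' (K u) = 0"
    and P: "placed P0 s" "planned k s" "set (take k A) \<subseteq> P0"
      "\<And>z. z \<in> P0 \<Longrightarrow> arr s ''col'' z < q \<and> arr s ''out'' z < q \<and> arr s ''in'' z \<le> q"
      "\<And>u z. u < m \<Longrightarrow> z \<in> P0 \<Longrightarrow> a z < a (K u)"
  shows "wp l A B place_three (\<lambda>t s'. t \<le> 400 * (m + 1) \<and>
      placed (P0 \<union> K ` {..<m}) s' \<and> planned k s') s"
proof -
  define W where "W = K ` {..<m}"
  have W: "finite W" "W = F ` {..<m}" "P0 \<inter> W = {}" "\<And>w z. w \<in> W \<Longrightarrow> z \<in> P0 \<Longrightarrow> a z < a w"
    "\<And>w. w \<in> W \<Longrightarrow> w < B"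
    using P(5) buf(2) key(3) unfolding W_def by auto
  have "inj_on K {..<m}"
    using key(2) by (intro linorder_inj_onI) (auto simp: less_imp_neq)
  then have cW: "card W = m"
    unfolding W_def by (simp add: card_image)
  \<comment> \<open>\<open>Q\<close> collects the loads placed so far. The pointers have passed only
    members of \<open>Q\<close>; so if the loads at \<open>i\<close> and \<open>j - 1\<close> are
    not in \<open>Q\<close>, they are the first to depart and the last to arrive among the
    rest.\<close>
  define J where "J Q s' \<longleftrightarrow> Q \<subseteq> W \<and> three h q a P0 Q (W - Q)
        (arr s' ''row'') (arr s' ''col'') (arr s' ''in'') (arr s' ''out'')
        (scal s' ''f'') (scal s' ''g'') (scal s' ''p'') \<and>
      fits h c (P0 \<union> Q) (arr s' ''row'') (arr s' ''col'') (arr s' ''in'') (arr s' ''out'') \<and>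
      planned k s' \<and> (\<forall>z\<in>W. arr s' ''done'' z = (if z \<in> Q then 1 else 0)) \<and>
      scal s' ''i'' \<le> m \<and> (\<forall>u<scal s' ''i''. K u \<in> Q) \<and>
      scal s' ''j'' \<le> m \<and> (\<forall>u. scal s' ''j'' \<le> u \<and> u < m \<longrightarrow> F u \<in> Q) \<and>
      scal s' ''t'' = card (W - Q)" for Q and s' :: mstate
  \<comment> \<open>Each branch of \<open>place_next\<close> lowers exactly one summand, and the
    initial value is \<open>3 * m\<close>.\<close>
  define \<Phi> where "\<Phi> s' = (m - scal s' ''i'') + scal s' ''j'' + scal s' ''t''" for s' :: mstate
  let ?s0 = "s\<lparr>scal := (scal s)(''f'' := 0, ''g'' := 0, ''p'' := 0, ''i'' := 0, ''j'' := m, ''t'' := m)\<rparr>"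
  have "wp l A B (While (Less (Num 0) (Var ''t'')) place_next)
     (\<lambda>t s'. t \<le> \<Phi> ?s0 * (1 + bcost (Less (Num 0) (Var ''t'')) + 100) + (1 + bcost (Less (Num 0) (Var ''t''))) \<and>
      (\<exists>Q. J Q s') \<and> \<not> bval (Less (Num 0) (Var ''t'')) s' \<and> same place_next ?s0 s') ?s0"
  proof (rule wp_while)
    have "three h q a P0 {} (W - {}) (arr s ''row'') (arr s ''col'') (arr s ''in'') (arr s ''out'') 0 0 0"
      using P W unfolding three_def placed_def by auto
    then have "J {} ?s0"
      using P mark cW unfolding J_def W_def by (auto simp: placed_def planned_def)
    then show "\<exists>Q. J Q ?s0" by blast
  next
    fix s1
    assume "\<exists>Q. J Q s1" and sm: "same place_next ?s0 s1"
      and "bval (Less (Num 0) (Var ''t'')) s1"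
    then obtain Q where J: "J Q s1" and t: "0 < scal s1 ''t''" by auto
    have s1: "arr s1 ''key'' = K" "arr s1 ''buf'' = F" "scal s1 ''h'' = h" "scal s1 ''q'' = q"
      using sm s key buf by (auto simp: same_def mods_place_next)
    define i j where "i = scal s1 ''i''" and "j = scal s1 ''j''"
    have T: "three h q a P0 Q (W - Q)
        (arr s1 ''row'') (arr s1 ''col'') (arr s1 ''in'') (arr s1 ''out'')
        (scal s1 ''f'') (scal s1 ''g'') (scal s1 ''p'')"
      and fit: "fits h c (P0 \<union> Q) (arr s1 ''row'') (arr s1 ''col'') (arr s1 ''in'') (arr s1 ''out'')"
      and QW: "Q \<subseteq> W" and pl: "planned k s1"
      and dn: "\<And>z. z \<in> W \<Longrightarrow> arr s1 ''done'' z = (if z \<in> Q then 1 else 0)"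
      and i: "i \<le> m" "\<And>u. u < i \<Longrightarrow> K u \<in> Q"
      and j: "j \<le> m" "\<And>u. j \<le> u \<Longrightarrow> u < m \<Longrightarrow> F u \<in> Q"
      and tc: "scal s1 ''t'' = card (W - Q)"
      using J unfolding J_def i_def j_def by auto
    have "W - Q \<noteq> {}" using t unfolding tc by (simp add: card_gt_0_iff)
    then obtain v where v: "v \<in> W" "v \<notin> Q" by auto
    have im: "i < m"
    proof -
      obtain u where "u < m" "v = K u" using v(1) unfolding W_def by auto
      then show ?thesis using i(2)[of u] v(2) by (cases "u < i") auto
    qed
    have jm: "0 < j"
    proof -
      obtain u where "u < m" "v = F u" using v(1) unfolding W(2) by auto
      then show ?thesis using j(2)[of u] v(2) by (cases "j \<le> u") auto
    qed
    have iB: "i + 1 < B" "j < B" using im j(1) s(2) B(1) by auto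
    let ?x = "K i" let ?y = "F (j - 1)"
    have "?x \<in> W" using im unfolding W_def by auto
    moreover have "?y \<in> W" using jm j(1) unfolding W(2) by auto
    ultimately have xy: "?x \<in> W" "?y \<in> W" .
    show "wp l A B place_next (\<lambda>t s'. t \<le> 100 \<and> (\<exists>Q. J Q s') \<and> \<Phi> s' < \<Phi> s1) s1"
    proof (cases "?x \<in> Q")
      case True
      let ?s = "s1\<lparr>scal := (scal s1)(''i'' := Suc i)\<rparr>"
      have "J Q ?s"
        using J True im unfolding J_def i_def by (auto simp: planned_def less_Suc_eq)
      moreover have "\<Phi> ?s < \<Phi> s1"
        using im unfolding \<Phi>_def i_def by auto
      ultimately show ?thesis
        unfolding place_next_def wp_simps
        using True dn[OF xy(1)] iB(1) s1 i_def by auto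
    next
      case x: False
      show ?thesis
      proof (cases "?y \<in> Q")
        case True
        let ?s = "s1\<lparr>scal := (scal s1)(''j'' := j - Suc 0)\<rparr>"
        have "F u \<in> Q" if "j - Suc 0 \<le> u" "u < m" for u
          using j(2)[of u] True that by (cases "u = j - Suc 0") auto
        then have "J Q ?s"
          using J j(1) unfolding J_def by (auto simp: planned_def)
        moreover have "\<Phi> ?s < \<Phi> s1"
          using jm unfolding \<Phi>_def j_def by auto
        ultimately show ?thesis
          unfolding place_next_def wp_simps
          using True x dn xy iB(2) s1 i_def j_def by auto
      next
        case y: False
        have first: "?x < v" if v: "v \<in> W - Q" "v \<noteq> ?x" for v
        proof -
          obtain u where u: "u < m" "v = K u" using v(1) unfolding W_def by auto
          then have "\<not> u < i" "u \<noteq> i" using i(2)[of u] v by auto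
          then show ?thesis using key(2)[of i u] u by auto
        qed
        have last: "a v < a ?y" if v: "v \<in> W - Q" "v \<noteq> ?y" for v
        proof -
          obtain u where u: "u < m" "v = F u" using v(1) unfolding W(2) by auto
          then have "\<not> j \<le> u" "u \<noteq> j - 1" using j(2)[of u] v by auto
          then show ?thesis using buf(3)[of u "j - 1"] u jm j(1) by auto
        qed
        have xB: "?x < B" "?y < B" using W(5) xy by auto
        have bnd: "scal s1 ''f'' \<le> h" "scal s1 ''g'' \<le> h" "scal s1 ''p'' \<le> h"
          "scal s1 ''f'' + scal s1 ''g'' + scal s1 ''p'' = card Q"
          using T unfolding three_def by auto
        have hB: "h + 1 < B" "q + 2 < c" "q + 2 < B" using B(1,3) q by auto
        have tp: "card (W - insert w Q) = scal s1 ''t'' - 1" if "w \<in> W" "w \<notin> Q" for w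
        proof -
          have "W - insert w Q = (W - Q) - {w}" by auto
          moreover have "w \<in> W - Q" using that by simp
          ultimately show ?thesis unfolding tc by (simp only: card_Diff_singleton)
        qed
        have fin: "(\<exists>Q. J Q s') \<and> \<Phi> s' < \<Phi> s1"
          if w: "w \<in> W" "w \<notin> Q"
            and T': "three h q a P0 (insert w Q) (W - Q - {w})
              ((arr s1 ''row'')(w := i')) ((arr s1 ''col'')(w := k')) ((arr s1 ''in'')(w := e'))
              ((arr s1 ''out'')(w := x')) (scal s' ''f'') (scal s' ''g'') (scal s' ''p'')"
            and s': "arr s' ''row'' = (arr s1 ''row'')(w := i')" "arr s' ''col'' = (arr s1 ''col'')(w := k')"
              "arr s' ''in'' = (arr s1 ''in'')(w := e')" "arr s' ''out'' = (arr s1 ''out'')(w := x')"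
              "arr s' ''done'' = (arr s1 ''done'')(w := 1)" "scal s' ''i'' = i" "scal s' ''j'' = j"
              "scal s' ''t'' = scal s1 ''t'' - 1" "nstored s' = nstored s1" "plan s' = plan s1"
            and f: "i' < h" "k' < c" "e' < c" "x' < c" "nearby e' k'" "nearby x' k'"
          for w i' k' e' x' and s' :: mstate
        proof -
          have "w \<notin> P0" using W(3) w by auto
          then have "planned k s'"
            using planned_put[OF pl P(3) _ s'(9,10,1,2,3)] by simp
          moreover have "fits h c (insert w (P0 \<union> Q)) (arr s' ''row'') (arr s' ''col'')
              (arr s' ''in'') (arr s' ''out'')"
            unfolding s' by (intro fits_insert fit f)
          moreover have "W - Q - {w} = W - insert w Q" by auto
          ultimately have "J (insert w Q) s'"
            using w QW T' dn i j tp[OF w] unfolding J_def s'(6,7,8) by (simp add: s')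
          moreover have "\<Phi> s' < \<Phi> s1"
            using t unfolding \<Phi>_def s'(6,7,8) i_def j_def by simp
          ultimately show ?thesis by blast
        qed
        have nd: "arr s1 ''done'' ?x = 0" "arr s1 ''done'' ?y = 0"
          using dn xy x y by auto
        have nb: "nearby k k" "nearby (Suc k) k" "nearby k (Suc k)" for k
          by (auto simp: nearby_def)
        let ?f = "scal s1 ''f''" and ?g = "scal s1 ''g''" and ?p = "scal s1 ''p''"
        define s2 where "s2 = s1\<lparr>scal := (scal s1)(''x'' := ?x, ''y'' := ?y)\<rparr>"
        have tB: "scal s1 ''t'' < B"
          using tc card_mono[of W "W - Q"] W(1) cW s(2) B(1) by auto
        have UI: "?x \<in> W - Q" "?y \<in> W - Q" using xy x y by auto
        have last_step: "wp l A B place_next (\<lambda>t s'. t \<le> 100 \<and> (\<exists>Q. J Q s') \<and> \<Phi> s' < \<Phi> s1) s1"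
          if w: "w \<in> W - Q"
            and T': "three h q a P0 (insert w Q) (W - Q - {w})
              ((arr s1 ''row'')(w := i')) ((arr s1 ''col'')(w := k')) ((arr s1 ''in'')(w := e'))
              ((arr s1 ''out'')(w := x')) f g p"
            and f: "i' < h" "k' < c" "e' < c" "x' < c" "nearby e' k'" "nearby x' k'"
            and one: "wp l A B place_one (\<lambda>t s'. t \<le> 60 \<and> effect s2 w i' k' e' x' f g p s') s2"
          for w i' k' e' x' f g p
        proof -
          have wB: "w < B" using W(5) w by auto
          let ?C = "AssignArr ''done'' (Var ''x'') (Num 1) ;; ''t'' ::= Sub (Var ''t'') (Num 1)"
          have "wp l A B ?C (\<lambda>t2 s'. t + t2 \<le> 70 \<and> (\<exists>Q. J Q s') \<and> \<Phi> s' < \<Phi> s1) s3"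
            if s3: "t \<le> 60 \<and> effect s2 w i' k' e' x' f g p s3" for t s3
          proof -
            note e = s3[unfolded effect_def]
            let ?s4 = "s3\<lparr>arr := (arr s3)(''done'' := (arr s3 ''done'')(w := 1)),
              scal := (scal s3)(''t'' := scal s1 ''t'' - 1)\<rparr>"
            have "(\<exists>Q. J Q ?s4) \<and> \<Phi> ?s4 < \<Phi> s1"
              by (rule fin[where w = w and i' = i' and k' = k' and e' = e' and x' = x'])
                (use e w T' f in \<open>auto simp: s2_def i_def j_def\<close>)
            then show ?thesis
              unfolding wp_simps using e wB tB hB by (auto simp: s2_def)
          qed
          then have "wp l A B place_one (\<lambda>t1. wp l A B ?C (\<lambda>t2 s'. t1 + t2 \<le> 70 \<and> (\<exists>Q. J Q s') \<and> \<Phi> s' < \<Phi> s1)) s2"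
            by (rule wp_conseq[OF one])
          then have "wp l A B (place_one ;; ?C) (\<lambda>t s'. t \<le> 70 \<and> (\<exists>Q. J Q s') \<and> \<Phi> s' < \<Phi> s1) s2"
            unfolding wp_simps(4) .
          moreover define R where "R = (place_one ;; ?C)"
          ultimately have 2: "wp l A B R (\<lambda>t s'. t \<le> 70 \<and> (\<exists>Q. J Q s') \<and> \<Phi> s' < \<Phi> s1) s2"
            by simp
          show ?thesis
            unfolding place_next_def R_def[symmetric]
            apply (rule wp_If_false)
            subgoal using s1 nd i_def by simp
            apply (rule wp_If_false)
            subgoal using s1 nd j_def by simp
            unfolding wp_simps(4)[of _ _ _ "_ ::= _"]
            using 2 s1 xB
            by (simp add: wp_simps(2) s2_def i_def j_def) (erule wp_conseq, simp)
        qed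
        have s2: "scal s2 ''x'' = ?x" "scal s2 ''y'' = ?y" "scal s2 ''h'' = h" "scal s2 ''q'' = q"
          "scal s2 ''f'' = ?f" "scal s2 ''g'' = ?g" "scal s2 ''p'' = ?p"
          using s1 by (simp_all add: s2_def)
        note one = wp_place_one[OF xB hB(1,3) bnd(1-3) s2]
        \<comment> \<open>The cases are exhaustive because \<open>f = h\<close> and
          \<open>f \<le> g\<close> force \<open>g = h\<close>.\<close>
        consider "?g < ?f"
          | "?f \<le> ?g" "?f < h" "?p < h" "?x = ?y"
          | "?f \<le> ?g" "?f < h" "?p < h" "?x \<noteq> ?y"
          | "?f \<le> ?g" "?p = h" "?g < h"
          | "?f \<le> ?g" "?p = h" "?g = h" "?f < h"
          | "?f = h" "?g = h"
          using bnd by linarith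
        then show ?thesis
        proof cases
          case 1
          note T' = three_middle[OF T 1 UI(2) last]
          show ?thesis
            by (rule last_step[OF UI(2) T' _ _ _ _ _ _ one(1)[OF 1]])
              (use 1 bnd hB nb in auto)
        next
          case 2
          have l2: "a v < a ?x" if "v \<in> W - Q" "v \<noteq> ?x" for v
            using last that 2 by simp
          note T' = three_right[OF T 2(1-3) UI(1) l2 first]
          show ?thesis
            by (rule last_step[OF UI(1) T' _ _ _ _ _ _ one(2)[OF 2]])
              (use 2 bnd hB nb in auto)
        next
          case 3
          have "?p < h \<or> ?g = h" "?y \<in> W - Q \<and> a ?x < a ?y"
            using 3 UI last[OF UI(1)] by auto
          note T' = three_left[OF T 3(1,2) this(1) UI(1) this(2) first]
          show ?thesis
            by (rule last_step[OF UI(1) T' _ _ _ _ _ _ one(3)[OF 3]])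
              (use 3 bnd hB nb in auto)
        next
          case 4
          note T' = three_middle_right[OF T 4 UI(2) last]
          show ?thesis
            by (rule last_step[OF UI(2) T' _ _ _ _ _ _ one(4)[OF 4]])
              (use 4 bnd hB nb in auto)
        next
          case 5
          have "?p < h \<or> ?g = h" "\<not> ?p < h"
            using 5 by auto
          note T' = three_left[OF T 5(1,4) this(1) UI(1) notE[OF this(2)] first]
          show ?thesis
            by (rule last_step[OF UI(1) T' _ _ _ _ _ _ one(5)[OF 5]])
              (use 5 bnd hB nb in auto)
        next
          case 6
          \<comment> \<open>Some load is without a cell, so fewer than \<open>3 * h\<close> cells
            are taken; as \<open>L\<close> and \<open>M\<close> are full, \<open>R\<close> has a
            free cell.\<close>
          have "card Q < card W"
            using QW v W(1) by (intro psubset_card_mono) auto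
          then have p: "?p < h" using bnd cW s(2) 6 by simp
          note T' = three_right_middle[OF T 6 p UI(1) first]
          show ?thesis
            by (rule last_step[OF UI(1) T' _ _ _ _ _ _ one(6)[OF 6 p]])
              (use p hB nb in auto)
        qed
      qed
    qed
  qed
  moreover have "\<Phi> ?s0 = 3 * m" by (simp add: \<Phi>_def)
  ultimately show ?thesis
    unfolding place_three_def wp_simps using s B(1)
    apply simp
    apply (erule wp_conseq)
    subgoal premises prems for t s'
    proof -
      obtain Q where Q: "J Q s'" "scal s' ''t'' = 0" using prems by auto
      then have "Q = W" using W(1) unfolding J_def by auto
      then show ?thesis
        using Q prems unfolding J_def three_def placed_def W_def by auto
    qed
    done
qed

end

section \<open>The complete program and its total running time\<close>

definition read_sort :: com where
  "read_sort = (read_loads ;; merge_sort)"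

definition block :: com where
  "block = (''m'' ::= Var ''h'' ;; read_sort ;; place_block ;; store_loads ;;
     ''b'' ::= Add (Var ''b'') (Num 1))"

definition last_block :: com where
  "last_block = (''m'' ::= Sub (Var ''n'') (Mul (Var ''q'') (Var ''h'')) ;;
     read_sort ;; place_three ;; store_loads)"

definition retrieve_loads :: com where
  "retrieve_loads = (''x'' ::= Num 1 ;;
     While (Less (Var ''x'') (Add (Var ''n'') (Num 1)))
       (DoRetrieve (Var ''x'')
          [(Arr ''row'' (Var ''x''), Arr ''col'' (Var ''x'')),
           (Arr ''row'' (Var ''x''), Arr ''out'' (Var ''x'')), (Num 0, Arr ''out'' (Var ''x''))] ;;
        ''x'' ::= Add (Var ''x'') (Num 1)))"

definition serve :: com where
  "serve = (While (Less (Var ''b'') (Var ''q'')) block ;; last_block ;; retrieve_loads)"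

text \<open>The test for \<open>n = 0\<close> keeps \<open>h\<close> positive. Bounding
  \<open>q\<close> by \<open>n div h\<close> ensures that the first \<open>q\<close> groups are
  complete, and bounding it by \<open>c - 3\<close> reserves three columns.\<close>

definition main :: com where
  "main = If (Less (Num 0) (Var ''n''))
     (''h'' ::= Var ''r'' ;;
      If (Less (Var ''n'') (Var ''r'')) (''h'' ::= Var ''n'') Skip ;;
      ''q'' ::= Quot (Var ''n'') (Var ''h'') ;;
      If (Less (Sub (Var ''c'') (Num 3)) (Var ''q'')) (''q'' ::= Sub (Var ''c'') (Num 3)) Skip ;;
      ''u'' ::= Quot (Mul (Var ''n'') (Add (Var ''n'') (Num 1))) (Num 2) ;;
      serve)
     Skip"

lemma mods_read_sort:
  "mvars read_sort = {''i'', ''x'', ''u'', ''d'', ''j'', ''e'', ''k'', ''w''}"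
  "marrs read_sort = {''buf'', ''key'', ''tmp''}" "\<not> acts read_sort"
  by (auto simp: read_sort_def mods_read_loads mods_merge_sort)

lemma mods_block:
  "mvars block = {''i'', ''x'', ''u'', ''d'', ''j'', ''e'', ''k'', ''w'', ''m'', ''b''}"
  "marrs block = {''buf'', ''key'', ''tmp'', ''row'', ''col'', ''in'', ''out''}"
  by (auto simp: block_def mods_read_sort mods_place_block mods_store_loads)

lemma mods_last_block:
  "''n'' \<notin> mvars last_block"
  by (auto simp: last_block_def mods_read_sort mods_place_three mods_store_loads)

lemma wp_seqI:
  assumes "wp l A B C1 P s" "\<And>t1 s1. P t1 s1 \<Longrightarrow> same C1 s s1 \<Longrightarrow> wp l A B C2 (\<lambda>t2. Q (t1 + t2)) s1"
  shows "wp l A B (C1 ;; C2) Q s"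
  unfolding wp_simps(4) by (rule wp_conseq[OF wp_same[OF assms(1)]]) (use assms(2) in auto)

lemma le_Suc_mult: "x \<le> (L + 1) * (x :: nat)"
  by simp

context storage
begin

lemma set_take_add:
  assumes "k + m \<le> n"
  shows "set (take (k + m) A) = set (take k A) \<union> (\<lambda>v. A ! (k + v)) ` {..<m}"
proof -
  have "set (take j A) = (!) A ` {..<j}" if "j \<le> n" for j
    using that n nth_image[of j A] by (simp add: atLeast0LessThan)
  then have "set (take (k + m) A) = (!) A ` {..<k + m}" "set (take k A) = (!) A ` {..<k}"
    using assms by auto
  moreover have "{..<k + m} = {..<k} \<union> (\<lambda>v. k + v) ` {..<m}"
  proof (intro equalityI subsetI)
    fix x assume "x \<in> {..<k + m}"
    then show "x \<in> {..<k} \<union> (\<lambda>v. k + v) ` {..<m}"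
      by (cases "x < k") (auto intro: image_eqI[of _ _ "x - k"])
  qed auto
  ultimately show ?thesis
    by (simp add: image_Un image_image)
qed

lemma arrival_less:
  assumes "z \<in> set (take k A)" "k + v < n"
  shows "a z < a (A ! (k + v))"
proof -
  obtain i where "i < k" "z = A ! i"
    using assms by (auto simp: in_set_conv_nth)
  then show ?thesis using a[of i] a[of "k + v"] assms(2) by simp
qed

lemma wp_read_sort:
  assumes m: "k + m \<le> n" "m \<le> 3 * h" "m = 3 * h \<Longrightarrow> k + m = n" and L: "m \<le> 2 ^ L"
    and s: "scal s ''h'' = h" "scal s ''m'' = m" "scal s ''u'' = (\<Sum>v\<in>{k..<n}. A ! v)"
      "nread s = k" "nstored s = k"
  shows "wp l A B read_sort (\<lambda>t s'. t \<le> 180 * ((L + 1) * (m + 1)) \<and>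
      (\<forall>v<m. arr s' ''buf'' v = A ! (k + v)) \<and>
      (\<forall>u v. u < v \<and> v < m \<longrightarrow> arr s' ''key'' u < arr s' ''key'' v) \<and>
      arr s' ''key'' ` {..<m} = (\<lambda>v. A ! (k + v)) ` {..<m} \<and>
      scal s' ''u'' = (\<Sum>v\<in>{k + m..<n}. A ! v) \<and> nread s' = k + min m (3 * h - 1)) s"
  unfolding read_sort_def
proof (rule wp_seqI[OF wp_read_loads[OF m(1,2) _ s]], goal_cases)
  case (2 t1 s1)
  note r = 2
  let ?X = "arr s1 ''key''"
  have X: "?X v = A ! (k + v)" if "v < m" for v
    using r that by auto
  have "inj_on ?X {..<m}"
    using X m(1) A(1) n by (auto simp: inj_on_def nth_eq_iff_index_eq)
  moreover have "?X v < B" if "v < m" for v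
    using X[OF that] load_le(2)[of "k + v"] that m by simp
  moreover have "scal s1 ''m'' = m"
    using r s by (auto simp: same_def mods_read_loads)
  ultimately have "wp l A B merge_sort (\<lambda>t s'. t \<le> 140 * ((L + 1) * (m + 1)) \<and>
      (\<forall>u v. u < v \<and> v < m \<longrightarrow> arr s' ''key'' u < arr s' ''key'' v) \<and>
      arr s' ''key'' ` {..<m} = ?X ` {..<m}) s1"
    using m B L by (intro wp_merge_sort) auto
  from wp_same[OF this] show ?case
  proof (rule wp_conseq, goal_cases)
    case (1 t s')
    have "t1 + t \<le> 180 * ((L + 1) * (m + 1))"
    proof -
      have "t \<le> 140 * ((L + 1) * (m + 1))" "t1 \<le> 40 * (m + 1)" using 1 r by blast+
      moreover have "x + y \<le> 180 * M" if "y \<le> 140 * M" "x \<le> 40 * z" "z \<le> M" for x y z M :: nat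
        using that by linarith
      ultimately show ?thesis using le_Suc_mult[of "m + 1" L] by blast
    qed
    moreover have "?X ` {..<m} = (\<lambda>v. A ! (k + v)) ` {..<m}"
      using X by (intro image_cong) auto
    moreover have "arr s' ''buf'' = arr s1 ''buf''" "scal s' ''u'' = scal s1 ''u''" "nread s' = nread s1"
      using 1 by (auto simp: same_def mods_merge_sort)
    ultimately show ?case
      using 1 r by simp
  qed
qed (use m in simp)

text \<open>Everything read has been stored, so the full lookahead is available again. The columns
  from \<open>b\<close> on are empty, and of these only \<open>b\<close> has served for
  entering.\<close>

definition blocks_done :: "nat \<Rightarrow> mstate \<Rightarrow> bool" where
  "blocks_done b s \<longleftrightarrow> scal s ''b'' = b \<and> b \<le> q \<and> nread s = b * h \<and>
     scal s ''u'' = (\<Sum>v\<in>{b * h..<n}. A ! v) \<and>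
     placed (set (take (b * h) A)) s \<and> planned (b * h) s \<and>
     (\<forall>z\<in>set (take (b * h) A). arr s ''col'' z < b \<and> arr s ''out'' z < b \<and> arr s ''in'' z \<le> b)"

lemma same_placed:
  assumes "same C s s'" "marrs C \<inter> {''row'', ''col'', ''in'', ''out''} = {}"
  shows "placed P s' = placed P s"
proof -
  have "arr s' x = arr s x" if "x \<in> {''row'', ''col'', ''in'', ''out''}" for x
    using assms that unfolding same_def by blast
  then show ?thesis by (simp add: placed_def)
qed

lemma wp_block:
  assumes b: "blocks_done b s" "b < q" and L: "3 * h \<le> 2 ^ L"
    and s: "scal s ''h'' = h"
  shows "wp l A B block (\<lambda>t s'. t \<le> 300 * ((L + 1) * (h + 1)) \<and> blocks_done (b + 1) s') s"
proof -
  have "(b + 1) * h \<le> q * h"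
    using b(2) by (intro mult_le_mono1) simp
  then have bh: "b * h + h \<le> n"
    using qn(1) by simp
  let ?k = "b * h"
  let ?P = "set (take ?k A)"
  let ?s0 = "s\<lparr>scal := (scal s)(''m'' := h)\<rparr>"
  note bd = b(1)[unfolded blocks_done_def]
  have P': "set (take ((b + 1) * h) A) = ?P \<union> (\<lambda>v. A ! (?k + v)) ` {..<h}"
    using set_take_add[OF bh] by (simp add: add.commute)
  have "wp l A B (read_sort ;; (place_block ;; (store_loads ;; ''b'' ::= Add (Var ''b'') (Num 1))))
    (\<lambda>t s'. t \<le> 290 * ((L + 1) * (h + 1)) \<and> blocks_done (b + 1) s') ?s0"
  proof (rule wp_seqI[OF wp_read_sort[where k = ?k and m = h and L = L]], goal_cases)
    case (10 t1 s1)
    have s1: "scal s1 ''m'' = h" "scal s1 ''b'' = b" "\<And>P. placed P s1 = placed P s"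
      "planned ?k s1 = planned ?k s" "arr s1 ''col'' = arr s ''col''" "arr s1 ''out'' = arr s ''out''"
      "arr s1 ''in'' = arr s ''in''"
      using 10(2) bd s by (auto simp: same_def mods_read_sort placed_def planned_def)
    let ?K = "arr s1 ''key''"
    have K: "?K ` {..<h} = (\<lambda>v. A ! (?k + v)) ` {..<h}" using 10(1) by simp
    have Kv: "\<exists>v<h. ?K u = A ! (?k + v)" if "u < h" for u
      using K that by (auto simp: image_def set_eq_iff)
    have 1: "wp l A B place_block (\<lambda>t s'. t \<le> 40 * (h + 1) \<and>
      placed (?P \<union> ?K ` {..<h}) s' \<and> planned ?k s' \<and>
      (\<forall>z\<in>?P \<union> ?K ` {..<h}. arr s' ''col'' z < b + 1 \<and> arr s' ''out'' z < b + 1 \<and>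
        arr s' ''in'' z \<le> b + 1)) s1"
    proof (rule wp_place_block, goal_cases)
      case (7 u)
      then show ?case using Kv[OF 7] load_le(2) bh by auto
    next
      case (8 u z)
      then show ?case using Kv[OF 8(1)] arrival_less[OF 8(2)] bh by auto
    qed (use s1 10(1) bd b(2) q in auto)
    show ?case
    proof (rule wp_seqI[OF 1], goal_cases)
      case (1 t2 s2)
      have "wp l A B store_loads (\<lambda>t s'. t \<le> 40 * (h + 1) \<and> planned (?k + h) s') s2"
        using 1 10 s1 bh by (intro wp_store_loads) (auto simp: same_def mods_place_block)
      then show ?case
      proof (rule wp_seqI, goal_cases)
        case (1 t3 s3)
        note s2 = \<open>t2 \<le> _ \<and> _\<close> \<open>same place_block s1 s2\<close>
        have "placed (set (take ((b + 1) * h) A)) s3"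
          using same_placed[OF 1(2)] s2(1) unfolding P' K by (simp add: mods_store_loads)
        moreover have "arr s3 = arr s2" using 1(2) by (simp add: same_def mods_store_loads fun_eq_iff)
        moreover have "scal s3 ''b'' = b" "scal s3 ''u'' = scal s1 ''u''" "nread s3 = nread s1"
          using 1(2) s2 s1 by (auto simp: same_def mods_store_loads mods_place_block)
        moreover have "t1 + (t2 + (t3 + 4)) \<le> 290 * ((L + 1) * (h + 1))"
        proof -
          have "h + 1 \<le> (L + 1) * (h + 1)" by (rule le_Suc_mult)
          moreover have "t1 \<le> 180 * ((L + 1) * (h + 1))" "t2 \<le> 40 * (h + 1)" "t3 \<le> 40 * (h + 1)"
            using 10(1) s2(1) 1(1) by blast+
          moreover have "x + (y + (z + 4)) \<le> 290 * M"
            if "u \<le> M" "x \<le> 180 * M" "y \<le> 40 * u" "z \<le> 40 * u" "1 \<le> u" for x y z u M :: nat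
            using that by linarith
          ultimately show ?thesis by simp
        qed
        \<comment> \<open>A group of \<open>h\<close> loads is read completely, without a deduced
          label.\<close>
        moreover have "min h (3 * h - 1) = h" using h by simp
        moreover have "b + 1 < B" using b(2) q B(3) by simp
        ultimately show ?case
          unfolding wp_simps using 10(1) s2(1) 1(1) b(2) K P'
          by (auto simp: blocks_done_def placed_def planned_def add.commute)
      qed
    qed
  qed (use bh h L s bd in \<open>auto simp: planned_def\<close>)
  then show ?thesis
    unfolding block_def wp_simps(2) wp_simps(4)[of _ _ _ "''m'' ::= _"] using s B(1)
    apply simp
    apply (erule wp_conseq)
    by (simp add: algebra_simps)
qed

lemma wp_last_block:
  assumes b: "blocks_done q s" and L: "3 * h \<le> 2 ^ L" and mark: "arr s ''done'' = (\<lambda>_. 0)"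
    and s: "scal s ''h'' = h" "scal s ''q'' = q" "scal s ''n'' = n"
  shows "wp l A B last_block (\<lambda>t s'. t \<le> 700 * ((L + 1) * (n + 1)) \<and> placed {1..n} s' \<and> planned n s') s"
proof -
  let ?k = "q * h"
  define m where "m = n - ?k"
  have m: "?k + m = n" "m \<le> 3 * h"
    using qn unfolding m_def by auto
  let ?P = "set (take ?k A)"
  let ?s0 = "s\<lparr>scal := (scal s)(''m'' := m)\<rparr>"
  note bd = b[unfolded blocks_done_def]
  have P': "{1..n} = ?P \<union> (\<lambda>v. A ! (?k + v)) ` {..<m}"
    using set_take_add[of ?k m] m(1) A(2) n by simp
  have "wp l A B (read_sort ;; (place_three ;; store_loads))
    (\<lambda>t s'. t \<le> 690 * ((L + 1) * (m + 1)) \<and> placed {1..n} s' \<and> planned n s') ?s0"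
  proof (rule wp_seqI[OF wp_read_sort[where k = ?k and m = m and L = L]], goal_cases)
    case (10 t1 s1)
    have s1: "scal s1 ''m'' = m" "scal s1 ''h'' = h" "scal s1 ''q'' = q" "\<And>P. placed P s1 = placed P s"
      "planned ?k s1 = planned ?k s" "arr s1 ''col'' = arr s ''col''" "arr s1 ''out'' = arr s ''out''"
      "arr s1 ''in'' = arr s ''in''" "arr s1 ''done'' = (\<lambda>_. 0)"
      using 10(2) bd s mark by (auto simp: same_def mods_read_sort placed_def planned_def)
    let ?K = "arr s1 ''key''" and ?F = "arr s1 ''buf''"
    have K: "?K ` {..<m} = (\<lambda>v. A ! (?k + v)) ` {..<m}" using 10(1) by simp
    have Kv: "\<exists>v<m. ?K u = A ! (?k + v)" if "u < m" for u
      using K that by (auto simp: image_def set_eq_iff)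
    have F: "?F v = A ! (?k + v)" if "v < m" for v using 10(1) that by simp
    have 1: "wp l A B place_three (\<lambda>t s'. t \<le> 400 * (m + 1) \<and>
      placed (?P \<union> ?K ` {..<m}) s' \<and> planned ?k s') s1"
    proof (rule wp_place_three[where F = ?F], goal_cases)
      case (7 u)
      then show ?case using Kv[OF 7] load_le(2) m(1) by fastforce
    next
      case 9
      then show ?case using F K by auto
    next
      case (10 u v)
      then show ?case using F[of u] F[of v] a[of "?k + u"] a[of "?k + v"] m(1) by simp
    next
      case (16 u z)
      then show ?case using Kv[OF 16(1)] arrival_less[OF 16(2)] m(1) by fastforce
    qed (use s1 10(1) bd m in auto)
    show ?case
    proof (rule wp_seqI[OF 1], goal_cases)
      case (1 t2 s2)
      have "wp l A B store_loads (\<lambda>t s'. t \<le> 40 * (m + 1) \<and> planned (?k + m) s') s2"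
        using 1 F s1 m(1) by (intro wp_store_loads) (auto simp: same_def mods_place_three)
      from wp_same[OF this] show ?case
      proof (rule wp_conseq, goal_cases)
        case (1 t3 s3)
        note s2 = \<open>t2 \<le> _ \<and> _\<close>
        have "placed {1..n} s3"
          using same_placed[OF conjunct2[OF 1]] s2 unfolding P' K by (simp add: mods_store_loads)
        moreover have "t1 + (t2 + t3) \<le> 690 * ((L + 1) * (m + 1))"
        proof -
          have "m + 1 \<le> (L + 1) * (m + 1)" by (rule le_Suc_mult)
          moreover have "t1 \<le> 180 * ((L + 1) * (m + 1))" "t2 \<le> 400 * (m + 1)" "t3 \<le> 40 * (m + 1)"
            using 10(1) s2 1 by blast+
          moreover have "x + (y + z) \<le> 690 * M"
            if "u \<le> M" "x \<le> 180 * M" "y \<le> 400 * u" "z \<le> 40 * u" for x y z u M :: nat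
            using that by linarith
          ultimately show ?thesis by blast
        qed
        ultimately show ?case
          using 1 m(1) by simp
      qed
    qed
  qed (use m L s bd in \<open>auto simp: planned_def\<close>)
  moreover have "690 * ((L + 1) * (m + 1)) + 10 \<le> 700 * ((L + 1) * (n + 1))"
  proof -
    have "(L + 1) * (m + 1) \<le> (L + 1) * (n + 1)" using m by (intro mult_le_mono2) simp
    moreover have "1 \<le> (L + 1) * (n + 1)" by simp
    ultimately show ?thesis by linarith
  qed
  moreover have "m < B" using m B by simp
  ultimately show ?thesis
    unfolding last_block_def wp_simps(2) wp_simps(4)[of _ _ _ "''m'' ::= _"]
    using s by (simp add: m_def) (erule wp_conseq, simp)
qed

lemma wp_retrieve_loads:
  assumes s: "scal s ''n'' = n" "planned n s"
  shows "wp l A B retrieve_loads (\<lambda>t s'. t \<le> 40 * (n + 1) \<and>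
      plan s' = map (store_act (arr s ''row'') (arr s ''col'') (arr s ''in'')) A @
        map (retrieve_act (arr s ''row'') (arr s ''col'') (arr s ''out'')) [1..<Suc n]) s"
proof -
  let ?re = "retrieve_act (arr s ''row'') (arr s ''col'') (arr s ''out'')"
  define I where "I s' \<longleftrightarrow> scal s' ''x'' \<le> n + 1 \<and> 1 \<le> scal s' ''x'' \<and>
      plan s' = plan s @ map ?re [1..<scal s' ''x'']" for s' :: mstate
  define C where "C = (DoRetrieve (Var ''x'')
          [(Arr ''row'' (Var ''x''), Arr ''col'' (Var ''x'')),
           (Arr ''row'' (Var ''x''), Arr ''out'' (Var ''x'')), (Num 0, Arr ''out'' (Var ''x''))] ;;
        ''x'' ::= Add (Var ''x'') (Num 1))"
  have C: "mvars C = {''x''}" "marrs C = {}" by (auto simp: C_def)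
  define b where "b = Less (Var ''x'') (Add (Var ''n'') (Num 1))"
  let ?s0 = "s\<lparr>scal := (scal s)(''x'' := 1)\<rparr>"
  have 1: "wp l A B (While b C) (\<lambda>t s'. t \<le> (n + 1 - scal ?s0 ''x'') * (1 + bcost b + 30) + (1 + bcost b) \<and>
      I s' \<and> \<not> bval b s' \<and> same C ?s0 s') ?s0"
  proof (rule wp_while[where \<Phi> = "\<lambda>s. n + 1 - scal s ''x''"])
    show "I ?s0" by (simp add: I_def)
  next
    fix s1 assume I: "I s1" and sm: "same C ?s0 s1" and "bval b s1"
    have s1: "arr s1 = arr s" "scal s1 ''n'' = n"
      using sm s by (auto simp: same_def C fun_eq_iff)
    then have x: "scal s1 ''x'' < n + 1" "1 \<le> scal s1 ''x''"
      using \<open>bval b s1\<close> I by (auto simp: b_def I_def)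
    show "wp l A B C (\<lambda>t s'. t \<le> 30 \<and> I s' \<and> n + 1 - scal s' ''x'' < n + 1 - scal s1 ''x'') s1"
      unfolding C_def wp_simps using I s1 x B(2)
      by (auto simp: I_def cval_def ccost_def retrieve_act_def simp del: trace.simps)
  qed
  have "plan s = map (store_act (arr s ''row'') (arr s ''col'') (arr s ''in'')) A"
    using s(2) n unfolding planned_def by simp
  moreover have "scal s' ''x'' = n + 1" if "I s'" "\<not> bval b s'" "same C ?s0 s'" for s'
  proof -
    have "scal s' ''n'' = n" using that(3) s by (auto simp: same_def C)
    then show ?thesis using that(1,2) by (auto simp: I_def b_def)
  qed
  ultimately have e: "scal s' ''x'' = n + 1"
      "plan s' = map (store_act (arr s ''row'') (arr s ''col'') (arr s ''in'')) A @ map ?re [1..<scal s' ''x'']"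
    if "I s'" "\<not> bval b s'" "same C ?s0 s'" for s'
    using that unfolding I_def by simp_all
  have "wp l A B (While b C) (\<lambda>t s'. 2 + t \<le> 40 * (n + 1) \<and>
      plan s' = map (store_act (arr s ''row'') (arr s ''col'') (arr s ''in'')) A @ map ?re [1..<Suc n]) ?s0"
  proof (rule wp_conseq[OF 1])
    fix t s'
    assume x: "t \<le> (n + 1 - scal ?s0 ''x'') * (1 + bcost b + 30) + (1 + bcost b) \<and>
      I s' \<and> \<not> bval b s' \<and> same C ?s0 s'"
    then have "plan s' = map (store_act (arr s ''row'') (arr s ''col'') (arr s ''in'')) A @ map ?re [1..<Suc n]"
      using e[of s'] by (simp only: Suc_eq_plus1) blast
    then show "2 + t \<le> 40 * (n + 1) \<and>
      plan s' = map (store_act (arr s ''row'') (arr s ''col'') (arr s ''in'')) A @ map ?re [1..<Suc n]"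
      using x by (simp add: b_def)
  qed
  then show ?thesis
    unfolding retrieve_loads_def C_def[symmetric] b_def[symmetric] wp_simps
    using B(2) by simp
qed

lemma wp_serve:
  assumes L: "3 * h \<le> 2 ^ L" and h_le: "h \<le> n"
    and s: "scal s ''h'' = h" "scal s ''q'' = q" "scal s ''n'' = n" "scal s ''b'' = 0"
      "scal s ''u'' = n * (n + 1) div 2" "arr s = (\<lambda>_ _. 0)" "nread s = 0" "nstored s = 0" "plan s = []"
  shows "wp l A B serve (\<lambda>t s'. t \<le> 3000 * ((L + 1) * n) \<and>
      (\<exists>rw cl en ex. valid a {1..n} rw cl en ex \<and> fits h c {1..n} rw cl en ex \<and>
        plan s' = map (store_act rw cl en) A @ map (retrieve_act rw cl ex) [1..<Suc n])) s"
proof -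
  let ?b = "Less (Var ''b'') (Var ''q'')"
  let ?T = "300 * ((L + 1) * (h + 1))"
  have "blocks_done 0 s"
    using s sum_loads_all by (auto simp: blocks_done_def placed_def planned_def valid_def fits_def)
  then have 1: "wp l A B (While ?b block) (\<lambda>t s'. t \<le> (q - scal s ''b'') * (1 + bcost ?b + ?T) + (1 + bcost ?b) \<and>
      blocks_done (scal s' ''b'') s' \<and> \<not> bval ?b s' \<and> same block s s') s"
  proof (intro wp_while[where I = "\<lambda>s. blocks_done (scal s ''b'') s" and \<Phi> = "\<lambda>s. q - scal s ''b''"])
    fix s1 assume b: "blocks_done (scal s1 ''b'') s1" and sm: "same block s s1" and lt: "bval ?b s1"
    have s1: "scal s1 ''h'' = h" "scal s1 ''q'' = q"
      using sm s by (auto simp: same_def mods_block)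
    then have "scal s1 ''b'' < q" using lt by simp
    then show "wp l A B block (\<lambda>t s'. t \<le> ?T \<and> blocks_done (scal s' ''b'') s' \<and>
        q - scal s' ''b'' < q - scal s1 ''b'') s1"
      by (intro wp_conseq[OF wp_block[OF b _ L s1(1)]]) (auto simp: blocks_done_def)
  qed (simp add: s)
  show ?thesis
    unfolding serve_def
  proof (rule wp_seqI[OF 1], goal_cases)
    case (1 t1 s1)
    have s1: "scal s1 ''h'' = h" "scal s1 ''q'' = q" "scal s1 ''n'' = n" "arr s1 ''done'' = (\<lambda>_. 0)"
      using 1(2) s by (auto simp: same_def mods_block)
    have "scal s1 ''b'' = q" using 1(1) s1 by (auto simp: blocks_done_def)
    then have "blocks_done q s1" using 1(1) by simp
    from wp_last_block[OF this L s1(4,1,2,3)] show ?case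
    proof (rule wp_seqI, goal_cases)
      case (1 t2 s2)
      have s2: "scal s2 ''n'' = n" using 1(2) s1 mods_last_block by (auto simp: same_def)
      show ?case
      proof (rule wp_conseq[OF wp_retrieve_loads[OF s2]], goal_cases)
        case 1
        then show ?case using \<open>t2 \<le> _ \<and> _\<close> by simp
      next
        case (2 t3 s3)
        have n1: "1 \<le> n" using h h_le by simp
        \<comment> \<open>The constant overhead per group is absorbed by its size:
          \<open>q * (h + 1) \<le> 2 * (q * h) \<le> 2 * n\<close>.\<close>
        have "q \<le> q * h" using h by simp
        moreover have "q * (h + 1) = q * h + q" by simp
        ultimately have qq: "q * (h + 1) \<le> 2 * n" "q \<le> n" using qn(1) by linarith+
        have "t1 \<le> q * (4 + ?T) + 4"
          using \<open>t1 \<le> _ \<and> _\<close> s by simp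
        also have "\<dots> = 4 * q + 300 * ((L + 1) * (q * (h + 1))) + 4"
          by (simp add: algebra_simps)
        also have "\<dots> \<le> 4 * n + 300 * ((L + 1) * (2 * n)) + 4"
          using qq by (intro add_mono mult_le_mono2) auto
        finally have t1: "t1 \<le> 4 * n + 600 * ((L + 1) * n) + 4" by (simp add: algebra_simps)
        have "t2 \<le> 700 * ((L + 1) * (n + 1))" using \<open>t2 \<le> _ \<and> _\<close> by simp
        also have "\<dots> \<le> 700 * ((L + 1) * (2 * n))"
          using n1 by (intro mult_le_mono2) simp
        finally have t2: "t2 \<le> 1400 * ((L + 1) * n)" by (simp add: algebra_simps)
        have "n \<le> (L + 1) * n" by (rule le_Suc_mult)
        moreover have "x + (y + z) \<le> 3000 * M" if "n \<le> M" "x \<le> 4 * n + 600 * M + 4"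
            "y \<le> 1400 * M" "z \<le> 40 * (n + 1)" for x y z M :: nat
          using that n1 by simp
        ultimately have "t1 + (t2 + t3) \<le> 3000 * ((L + 1) * n)"
          using t1 t2 conjunct1[OF 2] by blast
        then show ?case
          using 2 \<open>t2 \<le> _ \<and> _\<close> unfolding placed_def by blast
      qed
    qed
  qed
qed

end

lemma wp_main:
  assumes rc: "1 \<le> r" "3 \<le> c" "n \<le> r * c" and A: "distinct A" "set A = {1..n}" and npos: "0 < n"
    and L: "3 * r \<le> 2 ^ L"
  shows "wp (3 * r - 1) A (word_bound 3 r c) main (\<lambda>t s. t \<le> 3100 * ((L + 1) * n) \<and>
      serves r c A (plan s) \<and> without_relocations (plan s) \<and> column_adjacent_access (plan s))
    (init r c n)"
proof -
  define h where "h = min r n"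
  define q where "q = min (n div h) (c - 3)"
  define a where "a x = (THE i. i < n \<and> A ! i = x)" for x
  let ?B = "word_bound 3 r c"
  have len: "length A = n"
    using distinct_card[OF A(1)] A(2) by simp
  have a: "a (A ! i) = i" if "i < n" for i
    unfolding a_def using that A(1) len by (auto simp: nth_eq_iff_index_eq)
  have hs: "1 \<le> h" "h \<le> r" "h \<le> n" using rc npos unfolding h_def by auto
  have "n \<le> h * c" using rc unfolding h_def by (cases "r \<le> n") auto
  have N: "r \<le> r * c" "c \<le> r * c" "3 * r \<le> r * c" using rc by auto
  have Bs: "9 * (r * c) + 8 \<le> ?B" "n * (n + 1) < ?B"
  proof -
    define X Y where "X = r * c" and "Y = (X + 2) * (X + 2)"
    \<comment> \<open>With \<open>X + 2 \<ge> 5\<close>, the cube is at least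
      \<open>25 * (X + 2)\<close>, which exceeds \<open>9 * X + 8\<close>; already the square
      exceeds \<open>X * (X + 1)\<close>.\<close>
    have "3 \<le> X" using rc N unfolding X_def by linarith
    then have "5 * (X + 2) \<le> Y" "5 * Y \<le> (X + 2) * Y"
      unfolding Y_def by (intro mult_le_mono1; simp)+
    moreover have "X * (X + 1) + 1 \<le> Y"
      by (simp add: Y_def algebra_simps)
    moreover have "n * (n + 1) \<le> X * (X + 1)"
      using rc unfolding X_def by (intro mult_le_mono) auto
    moreover have "?B = (X + 2) * Y"
      by (simp add: word_bound_def X_def Y_def power3_eq_cube mult.assoc)
    moreover have "9 * X + 8 \<le> b \<and> i < b"
      if "5 * (X + 2) \<le> Y" "5 * Y \<le> z" "j + 1 \<le> Y" "i \<le> j" "b = z" for b z i j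
      using that by auto
    ultimately have "9 * X + 8 \<le> ?B \<and> n * (n + 1) < ?B"
      by blast
    then show "9 * (r * c) + 8 \<le> ?B" "n * (n + 1) < ?B"
      unfolding X_def by blast+
  qed
  have B': "9 * h + 1 < ?B" "n + 1 < ?B" "c + 1 < ?B"
    using Bs(1) N hs rc(3) by linarith+
  \<comment> \<open>The actual lookahead \<open>3 * r - 1\<close> is sufficient for
    \<open>h \<le> r\<close>. Only the first \<open>h\<close> rows are used.\<close>
  interpret storage h c n q "3 * r - 1" ?B A a
  proof
    show "q + 3 \<le> c" using rc unfolding q_def by auto
    show "q * h \<le> n"
      unfolding q_def by (metis div_times_less_eq_dividend min.cobounded1 mult_le_mono1 order_trans)
    show "n \<le> q * h + 3 * h"
    proof (cases "n div h \<le> c - 3")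
      case True
      then have "q * h + n mod h = n" by (simp add: q_def)
      moreover have "n mod h < h" using hs by simp
      ultimately show ?thesis by linarith
    next
      case False
      then have "q + 3 = c" using rc by (simp add: q_def)
      then have "q * h + 3 * h = h * c" by (metis add_mult_distrib mult.commute)
      then show ?thesis using \<open>n \<le> h * c\<close> by simp
    qed
  qed (use hs len A a Bs(2) B' in auto)
  let ?I = "init r c n"
  let ?s = "?I\<lparr>scal := (scal ?I)(''h'' := h, ''q'' := q, ''u'' := n * (n + 1) div 2)\<rparr>"
  have serve: "wp (3 * r - 1) A ?B serve (\<lambda>t s'. t \<le> 3000 * ((L + 1) * n) \<and>
      (\<exists>rw cl en ex. valid a {1..n} rw cl en ex \<and> fits h c {1..n} rw cl en ex \<and>
        plan s' = map (store_act rw cl en) A @ map (retrieve_act rw cl ex) [1..<Suc n])) ?s"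
    using hs L by (intro wp_serve) (auto simp: init_def)
  \<comment> \<open>The summand 60 pays for the assignments and tests that precede
    \<open>serve\<close>.\<close>
  have "wp (3 * r - 1) A ?B serve (\<lambda>t s. t + 60 \<le> 3100 * ((L + 1) * n) \<and>
      serves r c A (plan s) \<and> without_relocations (plan s) \<and> column_adjacent_access (plan s)) ?s"
  proof (rule wp_conseq[OF serve], goal_cases)
    case (1 t s)
    then obtain rw cl en ex where v: "valid a {1..n} rw cl en ex" "fits h c {1..n} rw cl en ex"
      "plan s = map (store_act rw cl en) A @ map (retrieve_act rw cl ex) [1..<Suc n]"
      by blast
    have "fits r c {1..n} rw cl en ex"
      using v(2) hs(2) unfolding fits_def by auto
    moreover have "t + 60 \<le> 3100 * ((L + 1) * n)"
    proof -
      have "1 \<le> (L + 1) * n" using npos by simp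
      then show ?thesis using conjunct1[OF 1] by linarith
    qed
    ultimately show ?case
      using plan_of_valid[OF v(1) _ A _ v(3)] a len by simp
  qed
  note fin = this
  have i: "scal ?I ''n'' = n" "scal ?I ''r'' = r" "scal ?I ''c'' = c"
    by (simp_all add: init_def)
  have bnd: "r < ?B" "n < ?B" "c < ?B" "c - 3 < ?B" "n div k < ?B" "n * (n + 1) div 2 < ?B" for k
  proof -
    show "r < ?B" "n < ?B" "c < ?B" "c - 3 < ?B" using Bs N rc(3) by linarith+
    then show "n div k < ?B" using div_le_dividend[of n k] by linarith
    show "n * (n + 1) div 2 < ?B" using Bs(2) div_le_dividend[of "n * (n + 1)" 2] by linarith
  qed
  have "h = (if n < r then n else r)" "q = (if c - 3 < n div h then c - 3 else n div h)"
    by (auto simp: h_def q_def)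
  then show ?thesis
    unfolding main_def using bnd i npos fin
    by (cases "n < r"; cases "c - 3 < n div h")
      (simp_all add: wp_simps(1,2,4,5), (erule wp_conseq, simp)+)
qed

theorem theorem3:
  shows "\<exists>(prog :: com) (k :: nat) (K :: real).
    \<forall>(r :: nat) (c :: nat) (n :: nat) (A :: nat list).
      1 \<le> r \<and> 3 \<le> c \<and> n \<le> r * c \<and> distinct A \<and> set A = {1..n} \<longrightarrow>
      (\<exists>t s. run (3 * r - 1) A (word_bound k r c) prog (init r c n) t s \<and>
             serves r c A (plan s) \<and>
             without_relocations (plan s) \<and>
             column_adjacent_access (plan s) \<and>
             real t \<le> K * (1 + real n * log 2 (real r + 1)))"
\<comment> \<open>The constant 18600 covers \<open>3100 * 5\<close>: the factor 3100 is that of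
  \<open>wp_main\<close>, and 5 comes from \<open>L + 1 \<le> 5 * g\<close>.\<close>
proof (rule exI[of _ main], rule exI[of _ 3], rule exI[of _ 18600], intro allI impI, elim conjE)
  fix r c n :: nat and A :: "nat list"
  assume rc: "1 \<le> r" "3 \<le> c" "n \<le> r * c" and A: "distinct A" "set A = {1..n}"
  define g where "g = log 2 (real r + 1)"
  \<comment> \<open>Rounding up gives \<open>r + 1 \<le> 2 ^ nat \<lceil>g\<rceil>\<close>; the
    additional 2 contributes a factor 4, which covers \<open>3 * r\<close>.\<close>
  define L where "L = nat \<lceil>g\<rceil> + 2"
  have g1: "1 \<le> g" using rc unfolding g_def by simp
  have "real r + 1 = 2 powr g" using rc unfolding g_def by simp
  also have "\<dots> \<le> 2 powr real (nat \<lceil>g\<rceil>)" by (intro powr_mono) linarith+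
  also have "\<dots> = 2 ^ nat \<lceil>g\<rceil>" by (simp add: powr_realpow)
  finally have "real (3 * r) \<le> real (2 ^ L)" unfolding L_def by simp
  then have L: "3 * r \<le> 2 ^ L" by (simp only: of_nat_le_iff)
  have "real L \<le> g + 3" using g1 unfolding L_def by linarith
  \<comment> \<open>The additive constant is absorbed because \<open>g \<ge> 1\<close>, which the
    argument \<open>r + 1\<close> of the logarithm secures even for a single row.\<close>
  then have gL: "real L + 1 \<le> 5 * g" using g1 by linarith
  show "\<exists>t s. run (3 * r - 1) A (word_bound 3 r c) main (init r c n) t s \<and>
      serves r c A (plan s) \<and> without_relocations (plan s) \<and> column_adjacent_access (plan s) \<and>
      real t \<le> 18600 * (1 + real n * log 2 (real r + 1))"
  proof (cases "n = 0")
    case True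
    have "wp (3 * r - 1) A (word_bound 3 r c) main (\<lambda>t s. t = 5 \<and> plan s = []) (init r c n)"
      unfolding main_def wp_simps(1,5) by (simp add: wp_simps(1,5) init_def True)
    moreover have "A = []" using A True by simp
    ultimately show ?thesis
      unfolding wp_def
      by (force simp: serves_def without_relocations_def column_adjacent_access_def True
          intro: executes.intros)
  next
    case False
    then obtain t s where run: "run (3 * r - 1) A (word_bound 3 r c) main (init r c n) t s"
        "t \<le> 3100 * ((L + 1) * n)"
        "serves r c A (plan s)" "without_relocations (plan s)" "column_adjacent_access (plan s)"
      using wp_main[OF rc A _ L] unfolding wp_def by auto
    have "real t \<le> real (3100 * ((L + 1) * n))"
      using run(2) by (simp only: of_nat_le_iff)
    also have "\<dots> = 3100 * ((real L + 1) * real n)" by (simp add: algebra_simps)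
    also have "\<dots> \<le> 3100 * (5 * g * real n)"
      using gL by (intro mult_left_mono mult_right_mono) auto
    also have "\<dots> \<le> 18600 * (1 + real n * g)"
    proof -
      have "0 \<le> real n * g" using g1 by simp
      then show ?thesis by (simp add: algebra_simps)
    qed
    finally show ?thesis using run unfolding g_def by blast
  qed
qed

end
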